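(* Let $k\ge 2$ be an even integer. For every $x>0$, \begin{align*} \sum_{n=1}^{\infty} D_{k,-1}(n) e^{-nx}=& \frac{1}{2} \log\left( \frac{x}{(2\pi)^k} \right)+\frac{1}{k}\Gamma\left(\frac{1}{k}\right)\zeta\left(1+\frac{1}{k}\right)x^{-\frac{1}{k}} \\ & + (-1)^k \sum_{\substack{j=-(k-1)\\ j\equiv k-1 \ (\mathrm{mod}\ 2)}}^{k-1} e^{ i \pi j} \sum_{m=1}^\infty \log \left[1- \exp\left(- e^{-\frac{i\pi j}{2k}} (2\pi)^{1+\frac{1}{k}} \left( \frac{m}{x} \right)^{\frac{1}{k} } \right) \right]. \end{align*}
   Context: $\zeta$ is the Riemann zeta function and $\Gamma$ the gamma function. For $k\in\mathbb{N}$, $D_{k,-1}(n)=\sum_{d\ge1,\ d^k\mid n}\left(\frac{n}{d^k}\right)^{-1}$. The sum over $j$ runs over $j=-(k-1),-(k-3),\dots,k-3,k-1$; $\log$ denotes the principal branch. *)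

theory Defs
  imports "HOL-Analysis.Analysis"
begin

definition D :: "nat \<Rightarrow> int \<Rightarrow> nat \<Rightarrow> real" where
  "D k r n = (\<Sum>d | 1 \<le> d \<and> d ^ k dvd n. (real n / real d ^ k) powi r)"

(* The Riemann zeta function on the half-plane Re s > 1, given by its Dirichlet series.
   The analytic continuation is not covered: for Re s \<le> 1 the value is unspecified junk
   of suminf. *)
definition zeta :: "complex \<Rightarrow> complex" where
  "zeta s = (\<Sum>n. 1 / of_nat (Suc n) powr s)"

(* {-(k-1), -(k-3), ..., k-3, k-1} *)
definition index_set :: "nat \<Rightarrow> int set" where
  "index_set k = {j. - (int k - 1) \<le> j \<and> j \<le> int k - 1 \<and> j mod 2 = (int k - 1) mod 2}"

definition log_term :: "nat \<Rightarrow> real \<Rightarrow> int \<Rightarrow> nat \<Rightarrow> complex" where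
  "log_term k x j m =
     Ln (1 - exp (- exp (- (\<i> * of_real pi * of_int j / (2 * of_nat k)))
                  * of_real ((2 * pi) powr (1 + 1 / real k))
                  * of_real ((real m / x) powr (1 / real k))))"

end

(*
  Expanding 1/m and grouping n = m d^k, the left side is the sum over d of G(d) with
  G(z) = -log (1 - exp (-x z^k)).  After the scaling z -> l z with l = x^(-1/k) the summand no longer
  depends on x.  Subtracting (k/2) log (1 + 1/z^2), whose sum over d is the product formula for sinh,
  removes the logarithmic singularity at 0 and leaves a function H with
  H(z) = O(z^2) at 0.  Summing residues of H(z) * 2 pi i l / (1 - exp (-2 pi i l z)) in the sector
  |arg z| <= theta gives the sum of H(d/l) as the integral of H plus a contribution of the ray
  arg z = theta.  On that ray the kernel is the derivative of log (1 - exp (2 pi i l z)); integration by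
  parts moves the derivative to H.  As H' is odd and meromorphic (k is even), the result can be evaluated
  by residues in theta <= arg z <= pi - theta, and its poles z^k = 2 pi i m (m a nonzero integer) produce
  the logarithms on the right side.  All contours become rectangles in the coordinate u = log z.
*)
theory Submission
  imports Defs "HOL-Complex_Analysis.Complex_Analysis" "HOL-Real_Asymp.Real_Asymp"
begin

text \<open>Residues of the summand itself are available only below
  \<open>arg z = pi / (2 k)\<close>, where \<open>1 - exp (- z^k)\<close> first vanishes and its
  logarithm branches. Beyond that ray only the derivative is single-valued. Integration by parts
  makes the upper sector reachable, because the primitive of the kernel that it introduces is
  holomorphic in the whole upper half-plane. Neither ray integral is ever evaluated. Conjugation in
  the first sector and reflection in the second both isolate an imaginary part, the same one up to
  sign, so it can be eliminated. The correction \<open>(k/2) log (1 + 1/z^2)\<close> grows like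
  \<open>- k log z\<close> at 0 just as \<open>G\<close> does, decays like \<open>z^(-2)\<close>,
  and adds to the derivative a single pole \<open>z = i\<close> in the upper sector. Its integral
  and that residue cancel two of the three parts of \<open>log (sinh (pi l) / (pi l))\<close>; the
  third, \<open>- log (2 pi l)\<close>, becomes the logarithm outside the series. In the coordinate
  \<open>u\<close> the factor in \<open>dz = z du\<close> turns both the kernel and the derivative
  of \<open>G\<close> into values of \<open>w / (exp w - 1)\<close>, up to constants.\<close>

section \<open>Integrals over horizontal lines and residues in rectangles\<close>

lemma absolutely_integrable_exp_decay:
  fixes f :: "real \<Rightarrow> complex"
  assumes cont: "continuous_on UNIV f"
    and top: "\<forall>\<^sub>F t in at_top. norm (f t) \<le> C * exp (- t)"
    and bot: "\<forall>\<^sub>F t in at_bot. norm (f t) \<le> C' * exp t"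
  shows "f absolutely_integrable_on UNIV"
proof -
  obtain T1 where T1: "\<And>t. t \<ge> T1 \<Longrightarrow> norm (f t) \<le> C * exp (- t)"
    using top by (auto simp: eventually_at_top_linorder)
  obtain T2 where T2: "\<And>t. t \<le> T2 \<Longrightarrow> norm (f t) \<le> C' * exp t"
    using bot by (auto simp: eventually_at_bot_linorder)
  define T' where "T' = max (max T1 (- T2)) 0"
  have "compact (f ` {-T'..T'})"
    by (intro compact_continuous_image continuous_on_subset[OF cont]) auto
  then obtain B where B: "\<And>t. t \<in> {-T'..T'} \<Longrightarrow> norm (f t) \<le> B"
    by (force simp: bounded_iff dest: compact_imp_bounded)
  \<comment> \<open>\<open>B * exp T'\<close> pays for the middle interval, where
    \<open>exp (- \<bar>t\<bar>)\<close> can be as small as \<open>exp (- T')\<close>.\<close>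
  define M where "M = max (max C C') (max 0 (B * exp T'))"
  have bound: "norm (f t) \<le> M * exp (- \<bar>t\<bar>)" for t
  proof (cases "t \<in> {-T'..T'}")
    case True
    have "0 \<le> B" using B[OF True] norm_ge_zero[of "f t"] by linarith
    have "norm (f t) \<le> B * (exp T' * exp (- T'))" using B[OF True] by (simp flip: exp_add)
    also have "\<dots> \<le> B * (exp T' * exp (- \<bar>t\<bar>))"
      using True \<open>0 \<le> B\<close> by (intro mult_left_mono) auto
    also have "\<dots> \<le> M * exp (- \<bar>t\<bar>)"
      unfolding M_def mult.assoc[symmetric] by (intro mult_right_mono) auto
    finally show ?thesis .
  next
    case False
    then have "(t \<ge> 0 \<and> t \<ge> T1) \<or> (t \<le> 0 \<and> t \<le> T2)" by (auto simp: T'_def)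
    then have "norm (f t) \<le> C * exp (- \<bar>t\<bar>) \<or> norm (f t) \<le> C' * exp (- \<bar>t\<bar>)"
      using T1[of t] T2[of t] by auto
    moreover have "C * exp (- \<bar>t\<bar>) \<le> max C C' * exp (- \<bar>t\<bar>)" "C' * exp (- \<bar>t\<bar>) \<le> max C C' * exp (- \<bar>t\<bar>)"
      by (intro mult_right_mono; simp)+
    ultimately have "norm (f t) \<le> max C C' * exp (- \<bar>t\<bar>)" by linarith
    also have "\<dots> \<le> M * exp (- \<bar>t\<bar>)"
      by (intro mult_right_mono) (auto simp: M_def)
    finally show ?thesis .
  qed
  have i1: "(\<lambda>t::real. exp (- \<bar>t\<bar>)) integrable_on {0..}"
    using has_integral_exp_minus_to_infinity[of 1 0]
    by (auto simp: integrable_on_def intro!: has_integral_eq[of _ "\<lambda>t. exp (-t)" "\<lambda>t. exp (- \<bar>t\<bar>)" for t])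
  then have i2: "(\<lambda>t::real. exp (- \<bar>t\<bar>)) integrable_on {..0}"
  proof -
    have "uminus ` {..0::real} = {0..}" by (auto simp: image_iff intro: exI[of _ "- x" for x])
    moreover have "(\<lambda>t::real. exp (- \<bar>t\<bar>)) absolutely_integrable_on {0..}"
      using i1 by (intro nonnegative_absolutely_integrable_1) auto
    ultimately have "(\<lambda>t::real. \<bar>-1\<bar> *\<^sub>R exp (- \<bar>- t\<bar>)) absolutely_integrable_on {..0}"
      using absolutely_integrable_change_of_variables_real
        [of "{..0}" uminus "\<lambda>_. -1" "\<lambda>t::real. exp (- \<bar>t\<bar>)"] DERIV_minus[OF DERIV_ident]
      by auto
    then show ?thesis by (simp add: absolutely_integrable_on_def)
  qed
  have "(\<lambda>t::real. exp (- \<bar>t\<bar>)) integrable_on ({..0} \<union> {0..})"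
    by (rule integrable_Un[OF _ i2 i1]) (auto intro: negligible_subset[of "{0}"])
  moreover have "{..0} \<union> {0..} = (UNIV::real set)" by auto
  ultimately have "(\<lambda>t::real. M * exp (- \<bar>t\<bar>)) integrable_on UNIV"
    by (auto intro: integrable_on_mult_right)
  moreover have "f \<in> borel_measurable (lebesgue_on UNIV)"
    using cont by (intro continuous_imp_measurable_on_sets_lebesgue) auto
  ultimately show ?thesis
    by (intro measurable_bounded_by_integrable_imp_absolutely_integrable[of f UNIV "\<lambda>t. M * exp (- \<bar>t\<bar>)"])
       (use bound in auto)
qed

text \<open>Dominated convergence with \<open>norm f\<close> as majorant. The endpoints stay
  arbitrary so that later contours can be made to pass between poles.\<close>

lemma integral_interval_tendsto_UNIV:
  fixes f :: "real \<Rightarrow> complex"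
  assumes f: "f absolutely_integrable_on UNIV"
    and a: "filterlim a at_bot sequentially" and b: "filterlim b at_top sequentially"
  shows "(\<lambda>n. integral {a n..b n} f) \<longlonglongrightarrow> integral UNIV f"
proof -
  have int: "f integrable_on {s..t}" for s t
    using f by (auto simp: absolutely_integrable_on_def intro: integrable_on_subinterval)
  have eq: "integral {s..t} f = integral UNIV (\<lambda>x. if x \<in> {s..t} then f x else 0)" for s t
    by (rule integral_restrict_UNIV[symmetric])
  have "(\<lambda>n. integral UNIV (\<lambda>x. if x \<in> {a n..b n} then f x else 0)) \<longlonglongrightarrow> integral UNIV f"
  proof (rule dominated_convergence(2)[where h = "\<lambda>x. norm (f x)"])
    show "(\<lambda>x. if x \<in> {a n..b n} then f x else 0) integrable_on UNIV" for n
      using int by (simp only: integrable_restrict_UNIV)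
    show "(\<lambda>x. norm (f x)) integrable_on UNIV"
      using f by (simp add: absolutely_integrable_on_def)
    show "(\<lambda>n. if x \<in> {a n..b n} then f x else 0) \<longlonglongrightarrow> f x" for x
    proof (rule tendsto_eventually)
      show "\<forall>\<^sub>F n in sequentially. (if x \<in> {a n..b n} then f x else 0) = f x"
        using filterlim_at_bot[THEN iffD1, OF a, rule_format, of x] 
          filterlim_at_top[THEN iffD1, OF b, rule_format, of x]
        by eventually_elim auto
    qed
  qed auto
  then show ?thesis by (simp add: eq)
qed

lemma contour_integral_linepath_same_Im:
  assumes "a < b"
  shows "contour_integral (linepath (Complex a y) (Complex b y)) f = integral {a..b} (\<lambda>t. f (Complex t y))"
proof -
  have "contour_integral (linepath (Complex a y) (Complex b y)) f =
        integral {0..1} (\<lambda>x. f (linepath (Complex a y) (Complex b y) x)) * of_real (b - a)"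
    by (simp add: contour_integral_integral Complex_eq flip: right_diff_distrib of_real_diff)
  also have "(\<lambda>x. f (linepath (Complex a y) (Complex b y) x)) 
      = (\<lambda>x. f (Complex (linepath a b x) y))"
    by (auto simp: linepath_def complex_eq_iff algebra_simps intro!: ext arg_cong[of _ _ f])
  also have "integral {0..1} \<dots> * of_real (b - a) = contour_integral (linepath (of_real a) (of_real b)) (\<lambda>z. f (z + \<i> * y))"
    by (simp add: contour_integral_integral linepath_def Complex_eq scaleR_conv_of_real mult.commute)
  also have "\<dots> = integral {a..b} (\<lambda>t. f (Complex t y))"
    using assms by (subst contour_integral_linepath_Reals_eq) (auto simp: Complex_eq)
  finally show ?thesis .
qed

text \<open>The residue theorem with the two vertical sides, each of length \<open>d - c\<close>,
  moved into the error term. The horizontal sides appear as real integrals, so later limits need no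
  contour integrals.\<close>

lemma residue_rectangle:
  fixes f :: "complex \<Rightarrow> complex"
  assumes "open S" "convex S" "finite Q" and holo: "f holomorphic_on S - Q"
    and ab: "a < b" "c < d" and sub: "cbox (Complex a c) (Complex b d) \<subseteq> S"
    and Q: "Q \<subseteq> box (Complex a c) (Complex b d)"
    and B: "B \<ge> 0"
      "\<And>y. y \<in> {c..d} \<Longrightarrow> norm (f (Complex a y)) \<le> B"
      "\<And>y. y \<in> {c..d} \<Longrightarrow> norm (f (Complex b y)) \<le> B"
  shows "norm (integral {a..b} (\<lambda>t. f (Complex t c)) - integral {a..b} (\<lambda>t. f (Complex t d))
           - 2 * pi * \<i> * (\<Sum>q\<in>Q. residue f q)) \<le> 2 * B * (d - c)"
proof -
  define R where "R = rectpath (Complex a c) (Complex b d)"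
  have img: "path_image R \<subseteq> S - Q"
    using path_image_rectpath_cbox_minus_box[of "Complex a c" "Complex b d"] sub Q ab
    by (auto simp: R_def)
  have cont: "continuous_on (path_image R) f"
    using holo img holomorphic_on_imp_continuous_on holomorphic_on_subset by blast
  have "contour_integral R f = 2 * pi * \<i> * (\<Sum>q\<in>Q. winding_number R q * residue f q)"
  proof (rule Residue_theorem[OF \<open>open S\<close> convex_connected[OF \<open>convex S\<close>] \<open>finite Q\<close> holo])
    show "path_image R \<subseteq> S - Q" by (fact img)
    show "\<forall>z. z \<notin> S \<longrightarrow> winding_number R z = 0"
      using sub ab unfolding R_def by (auto intro!: winding_number_rectpath_outside)
  qed (auto simp: R_def)
  also have "(\<Sum>q\<in>Q. winding_number R q * residue f q) = (\<Sum>q\<in>Q. residue f q)"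
    using Q by (intro sum.cong) (auto simp: R_def winding_number_rectpath)
  finally have res: "contour_integral R f = 2 * pi * \<i> * (\<Sum>q\<in>Q. residue f q)" .
  have pim: "path_image R = closed_segment (Complex a c) (Complex b c) \<union> closed_segment (Complex b c) (Complex b d)
     \<union> closed_segment (Complex b d) (Complex a d) \<union> closed_segment (Complex a d) (Complex a c)"
    by (simp add: R_def rectpath_def Let_def path_image_join Un_assoc)
  have int: "f contour_integrable_on linepath u v" if "closed_segment u v \<subseteq> path_image R" for u v
    using cont that by (intro contour_integrable_continuous_linepath) (auto intro: continuous_on_subset)
  have i1: "f contour_integrable_on linepath (Complex a c) (Complex b c)"
    and i2: "f contour_integrable_on linepath (Complex b c) (Complex b d)"
    and i3: "f contour_integrable_on linepath (Complex b d) (Complex a d)"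
    and i4: "f contour_integrable_on linepath (Complex a d) (Complex a c)"
    by (intro int; auto simp: pim)+
  have "contour_integral R f = contour_integral (linepath (Complex a c) (Complex b c)) f
     + contour_integral (linepath (Complex b c) (Complex b d)) f
     + contour_integral (linepath (Complex b d) (Complex a d)) f
     + contour_integral (linepath (Complex a d) (Complex a c)) f"
    using i1 i2 i3 i4 by (simp add: R_def rectpath_def Let_def)
  also have "contour_integral (linepath (Complex b d) (Complex a d)) f
      = - contour_integral (linepath (Complex a d) (Complex b d)) f"
    using contour_integral_reverse_linepath[of "Complex b d" "Complex a d" f]
      continuous_on_subset[OF cont, of "closed_segment (Complex b d) (Complex a d)"] by (auto simp: pim)
  finally have "integral {a..b} (\<lambda>t. f (Complex t c)) - integral {a..b} (\<lambda>t. f (Complex t d))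
           - 2 * pi * \<i> * (\<Sum>q\<in>Q. residue f q) 
     = - (contour_integral (linepath (Complex b c) (Complex b d)) f + contour_integral (linepath (Complex a d) (Complex a c)) f)"
    using res ab by (simp add: contour_integral_linepath_same_Im algebra_simps)
  also have "norm \<dots> \<le> norm (contour_integral (linepath (Complex b c) (Complex b d)) f)
     + norm (contour_integral (linepath (Complex a d) (Complex a c)) f)"
    by (subst norm_minus_cancel) (rule norm_triangle_ineq)
  also have "\<dots> \<le> B * norm (Complex b d - Complex b c) + B * norm (Complex a c - Complex a d)"
    using ab B i2 i4
    by (intro add_mono contour_integral_bound_linepath)
       (auto simp: closed_segment_same_Re closed_segment_eq_real_ivl complex_eq_iff split: if_splits;
        metis complex.collapse)+
  also have "\<dots> = 2 * B * (d - c)"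
  proof -
    have "Complex b d - Complex b c = of_real (d - c) * \<i>" "Complex a c - Complex a d = - of_real (d - c) * \<i>"
      by (simp_all add: complex_eq_iff)
    then show ?thesis using ab by (simp only: norm_mult norm_minus_cancel norm_of_real norm_ii)
  qed
  finally show ?thesis .
qed

text \<open>The generating function of the Bernoulli numbers, but with the value 0 at the poles and at 0.\<close>
definition bern :: "complex \<Rightarrow> complex" where
  "bern w = w / (exp w - 1)"

section \<open>Size of \<open>exp w - 1\<close> and of \<open>bern\<close>\<close>

text \<open>The circle passes halfway between the zeros of \<open>exp v - 1\<close>. Away from the
  imaginary axis the modulus of \<open>exp v\<close> alone suffices; near it, \<open>Im v\<close> is
  so close to an odd multiple of \<open>pi\<close> that \<open>Re (exp v) \<le> 0\<close>.\<close>

lemma norm_exp_minus_1_ge: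
  fixes v :: complex
  assumes "norm v = 2 * pi * (real n + 1 / 2)"
  shows "norm (exp v - 1) \<ge> 1 / 2"
proof -
  have nv: "norm v \<ge> pi" using assms by (simp add: algebra_simps)
  consider "Re v \<ge> 1" | "Re v \<le> -1" | "\<bar>Re v\<bar> < 1" by linarith
  then show ?thesis
  proof cases
    case 1
    have "norm (exp v - 1) \<ge> norm (exp v) - 1" using norm_triangle_ineq2[of "exp v" 1] by simp
    moreover have "exp (Re v) \<ge> 2" using 1 exp_ge_add_one_self[of "Re v"] by linarith
    ultimately show ?thesis by (simp)
  next
    case 2
    have "norm (exp v - 1) \<ge> 1 - norm (exp v)" using norm_triangle_ineq2[of 1 "exp v"] by (simp add: norm_minus_commute)
    moreover have "exp (Re v) \<le> 1 / 2" 
    proof -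
      have "exp (- Re v) \<ge> 2" using 2 exp_ge_add_one_self[of "- Re v"] by linarith
      then show ?thesis by (simp add: exp_minus field_simps)
    qed
    ultimately show ?thesis by simp
  next
    case 3
    have sq: "(norm v)\<^sup>2 = (Re v)\<^sup>2 + (Im v)\<^sup>2" by (simp add: cmod_power2)
    have le: "\<bar>Im v\<bar> \<le> norm v" by (rule abs_Im_le_cmod)
    \<comment> \<open>Since \<open>norm v + \<bar>Im v\<bar> \<ge> pi\<close>, factoring the
      difference of squares bounds the gap by \<open>1 / pi\<close>.\<close>
    have "(norm v - \<bar>Im v\<bar>) * pi \<le> (norm v - \<bar>Im v\<bar>) * (norm v + \<bar>Im v\<bar>)"
      using le nv by (intro mult_left_mono) auto
    also have "\<dots> = (Re v)\<^sup>2" using sq by (simp add: algebra_simps power2_eq_square)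
    also have "\<dots> \<le> 1" using 3 by (simp add: abs_square_le_1)
    finally have "norm v - \<bar>Im v\<bar> \<le> 1 / pi" by (simp add: field_simps)
    also have "1 / pi \<le> 1 / 2" using pi_gt3 by (simp add: field_simps)
    finally have "\<bar>Im v\<bar> - 2 * pi * n \<ge> pi / 2" using assms pi_gt3 by (simp add: algebra_simps)
    moreover have "\<bar>Im v\<bar> - 2 * pi * n \<le> pi" using le assms by (simp add: algebra_simps)
    ultimately have "cos (\<bar>Im v\<bar> - 2 * pi * n) \<le> cos (pi / 2)"
      by (intro cos_monotone_0_pi_le) auto
    moreover have "cos (\<bar>Im v\<bar> - 2 * pi * n) = cos (Im v)"
      using cos_int_2pin[of "int n"] sin_int_2pin[of "int n"] by (simp add: cos_diff)
    ultimately have "Re (exp v) \<le> 0" by (simp add: Re_exp mult_nonneg_nonpos)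
    then have "1 \<le> \<bar>Re (exp v - 1)\<bar>" by simp
    also have "\<dots> \<le> norm (exp v - 1)" by (rule abs_Re_le_cmod)
    finally show ?thesis by simp
  qed
qed

lemma norm_exp_minus_1_minus_le:
  fixes w :: complex
  assumes "norm w \<le> 1"
  shows "norm (exp w - 1 - w) \<le> 3 * norm w ^ 2"
proof -
  have "norm (exp w - (\<Sum>i\<le>1. w ^ i / fact i)) \<le> exp (norm w) * norm w ^ 2 / fact 1"
    using Taylor_exp_field[of w 1] by (simp add: numeral_2_eq_2)
  also have "exp (norm w) \<le> 3" using assms exp_le by (meson exp_le_cancel_iff order_trans)
  finally show ?thesis using assms by (simp add: algebra_simps mult_right_mono)
qed

lemma norm_exp_minus_1_ge_small:
  fixes w :: complex
  assumes "norm w \<le> 1 / 6"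
  shows "norm (exp w - 1) \<ge> norm w / 2"
proof -
  have "norm w \<le> norm (exp w - 1) + norm (exp w - 1 - w)"
    using norm_triangle_ineq4[of "exp w - 1" "exp w - 1 - w"] by simp
  also have "norm (exp w - 1 - w) \<le> 3 * norm w * norm w"
    using norm_exp_minus_1_minus_le[of w] assms by (simp add: power2_eq_square)
  \<comment> \<open>The radius \<open>1 / 6\<close> is chosen to give
    \<open>3 * norm w \<le> 1 / 2\<close>.\<close>
  also have "\<dots> \<le> 1 / 2 * norm w" using assms by (intro mult_right_mono) auto
  finally show ?thesis by simp
qed

lemma norm_bern_minus_1_le:
  assumes "norm w \<le> 1 / 6" "w \<noteq> 0"
  shows "norm (bern w - 1) \<le> 6 * norm w"
proof -
  have pos: "norm (exp w - 1) > 0" using norm_exp_minus_1_ge_small[OF assms(1)] assms(2)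
    by (smt (verit) zero_less_norm_iff half_gt_zero)
  then have "bern w - 1 = - (exp w - 1 - w) / (exp w - 1)" by (auto simp: bern_def field_simps)
  then have "norm (bern w - 1) = norm (exp w - 1 - w) / norm (exp w - 1)"
    by (simp add: norm_divide norm_minus_commute)
  also have "\<dots> \<le> 3 * norm w ^ 2 / (norm w / 2)"
    using norm_exp_minus_1_ge_small[OF assms(1)] norm_exp_minus_1_minus_le[of w] assms pos
    by (intro frac_le) auto
  also have "\<dots> = 6 * norm w" using assms by (simp add: power2_eq_square)
  finally show ?thesis .
qed

lemma norm_bern_le_circle:
  assumes "norm v = 2 * pi * (real n + 1 / 2)"
  shows "norm (bern v) \<le> 2 * norm v"
  using norm_exp_minus_1_ge[OF assms] frac_le[of "norm v" "norm v" "1/2" "norm (exp v - 1)"]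
  by (simp add: bern_def norm_divide)

lemma norm_bern_le_right:
  assumes "Re v \<ge> 1"
  shows "norm (bern v) \<le> 2 * norm v * exp (- Re v)"
proof -
  have "exp (Re v) \<ge> 2" using assms exp_ge_add_one_self[of "Re v"] by linarith
  then have "norm (exp v - 1) \<ge> exp (Re v) / 2"
    using norm_triangle_ineq2[of "exp v" 1] by simp
  then have "norm v / norm (exp v - 1) \<le> norm v / (exp (Re v) / 2)"
    by (intro frac_le) auto
  then show ?thesis by (simp add: bern_def norm_divide exp_minus field_simps)
qed

lemma norm_bern_le_left:
  assumes "Re v \<le> - 1"
  shows "norm (bern v) \<le> 2 * norm v"
proof -
  have "exp (- Re v) \<ge> 2" using assms exp_ge_add_one_self[of "- Re v"] by linarith
  then have "exp (Re v) \<le> 1 / 2" by (simp add: exp_minus field_simps)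
  then have "norm (exp v - 1) \<ge> 1 / 2"
    using norm_triangle_ineq2[of 1 "exp v"] by (simp add: norm_minus_commute)
  then have "norm v / norm (exp v - 1) \<le> norm v / (1 / 2)"
    by (intro frac_le) auto
  then show ?thesis by (simp add: bern_def norm_divide)
qed

text \<open>The extra \<open>v\<close> is the reason why the kernel below the real axis is not just
  the conjugate of the kernel above it.\<close>

lemma bern_minus: "exp v \<noteq> 1 \<Longrightarrow> bern (- v) = bern v + v"
  by (simp add: bern_def exp_minus field_simps)

lemma bern_cnj: "bern (cnj v) = cnj (bern v)"
  by (simp add: bern_def exp_cnj)

section \<open>Residues in infinite strips and at simple zeros\<close>

text \<open>The poles in the applications form an infinite sequence running to the right, so the
  domain \<open>S n\<close> varies with \<open>n\<close>: each one has to contain only finitely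
  many. The freely chosen edges \<open>a n\<close> and \<open>b n\<close> need bounds that tend to 0
  only along the sequence.\<close>

lemma residue_strip_limit:
  fixes f :: "complex \<Rightarrow> complex"
  assumes cd: "c < d"
    and int: "(\<lambda>t. f (Complex t c)) absolutely_integrable_on UNIV" "(\<lambda>t. f (Complex t d)) absolutely_integrable_on UNIV"
    and a: "filterlim a at_bot sequentially" and b: "filterlim b at_top sequentially"
    and S: "\<And>n. open (S n)" "\<And>n. convex (S n)" "\<And>n. finite (Q n)" "\<And>n. f holomorphic_on S n - Q n"
    and sub: "\<forall>\<^sub>F n in sequentially. cbox (Complex (a n) c) (Complex (b n) d) \<subseteq> S n"
    and Q: "\<forall>\<^sub>F n in sequentially. Q n \<subseteq> box (Complex (a n) c) (Complex (b n) d)"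
    and A: "\<forall>\<^sub>F n in sequentially. \<forall>y\<in>{c..d}. norm (f (Complex (a n) y)) \<le> A n" "A \<longlonglongrightarrow> 0"
    and B: "\<forall>\<^sub>F n in sequentially. \<forall>y\<in>{c..d}. norm (f (Complex (b n) y)) \<le> B n" "B \<longlonglongrightarrow> 0"
  shows "(\<lambda>n. 2 * pi * \<i> * (\<Sum>q\<in>Q n. residue f q))
     \<longlonglongrightarrow> integral UNIV (\<lambda>t. f (Complex t c)) - integral UNIV (\<lambda>t. f (Complex t d))"
proof -
  define E where "E = (\<lambda>n. integral {a n..b n} (\<lambda>t. f (Complex t c)) - integral {a n..b n} (\<lambda>t. f (Complex t d))
           - 2 * pi * \<i> * (\<Sum>q\<in>Q n. residue f q))"
  have ab: "\<forall>\<^sub>F n in sequentially. a n < b n"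
    using filterlim_at_bot[THEN iffD1, OF a, rule_format, of 0] 
      filterlim_at_top[THEN iffD1, OF b, rule_format, of 1] by eventually_elim auto
  have "\<forall>\<^sub>F n in sequentially. norm (E n) \<le> 2 * (\<bar>A n\<bar> + \<bar>B n\<bar>) * (d - c)"
    using ab sub Q A(1) B(1)
  proof eventually_elim
    case (elim n)
    have "norm (f (Complex (a n) y)) \<le> \<bar>A n\<bar> + \<bar>B n\<bar>" if "y \<in> {c..d}" for y
      using elim(4)[rule_format, OF that] by linarith
    moreover have "norm (f (Complex (b n) y)) \<le> \<bar>A n\<bar> + \<bar>B n\<bar>" if "y \<in> {c..d}" for y
      using elim(5)[rule_format, OF that] by linarith
    ultimately show ?case
      unfolding E_def using residue_rectangle[OF S elim(1) cd elim(2,3), of "\<bar>A n\<bar> + \<bar>B n\<bar>"] by simp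
  qed
  moreover have "(\<lambda>n. 2 * (\<bar>A n\<bar> + \<bar>B n\<bar>) * (d - c)) \<longlonglongrightarrow> 2 * (\<bar>0\<bar> + \<bar>0\<bar>) * (d - c)"
    by (intro tendsto_intros A B)
  ultimately have "E \<longlonglongrightarrow> 0" by (auto intro: Lim_null_comparison)
  then have "(\<lambda>n. integral {a n..b n} (\<lambda>t. f (Complex t c)) - integral {a n..b n} (\<lambda>t. f (Complex t d)) - E n)
     \<longlonglongrightarrow> integral UNIV (\<lambda>t. f (Complex t c)) - integral UNIV (\<lambda>t. f (Complex t d)) - 0"
    by (intro tendsto_diff integral_interval_tendsto_UNIV int a b)
  then show ?thesis by (simp add: E_def)
qed

text \<open>\<open>F\<close> has to agree with \<open>f / h\<close> only off the zeros of
  \<open>h\<close>: at a pole, division by zero gives a sum of fractions a default value that may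
  differ from that of the combined fraction.\<close>

lemma residue_quotient_simple_zero:
  assumes S: "open S" "z \<in> S" and f: "f holomorphic_on S" and h: "h holomorphic_on S"
    and h': "(h has_field_derivative h') (at z)" "h z = 0" "h' \<noteq> 0"
    and F: "\<And>w. h w \<noteq> 0 \<Longrightarrow> F w = f w / h w"
  shows "residue F z = f z / h'"
proof -
  have lim: "((\<lambda>w. h w / (w - z)) \<longlongrightarrow> h') (at z)"
    using h' by (simp add: has_field_derivative_iff)
  then have "\<forall>\<^sub>F w in at z. h w / (w - z) \<noteq> 0"
    by (rule tendsto_imp_eventually_ne) fact
  then obtain T where T: "open T" "z \<in> T" "\<And>w. w \<in> T \<Longrightarrow> w \<noteq> z \<Longrightarrow> h w \<noteq> 0"
    by (auto simp: eventually_at_topological)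
  show ?thesis
  proof (rule residue_simple')
    show "open (S \<inter> T)" "z \<in> S \<inter> T" using S T by auto
    have "(\<lambda>w. f w / h w) holomorphic_on S \<inter> T - {z}"
      using T by (intro holomorphic_on_divide holomorphic_on_subset[OF f] holomorphic_on_subset[OF h]) auto
    then show "F holomorphic_on S \<inter> T - {z}"
      by (rule holomorphic_transform) (use T F in auto)
    have "(f \<longlongrightarrow> f z) (at z)"
      using f S by (metis continuous_on_eq_continuous_at continuous_within holomorphic_on_imp_continuous_on)
    then have "((\<lambda>w. f w / (h w / (w - z))) \<longlongrightarrow> f z / h') (at z)"
      by (intro tendsto_divide lim h')
    then have "((\<lambda>w. f w / h w * (w - z)) \<longlongrightarrow> f z / h') (at z)" by simp
    moreover have "\<forall>\<^sub>F w in at z. f w / h w * (w - z) = F w * (w - z)"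
      using T F by (auto simp: eventually_at_topological)
    ultimately show "((\<lambda>w. F w * (w - z)) \<longlongrightarrow> f z / h') (at z)" by (rule Lim_transform_eventually)
  qed
qed

lemma convex_open_strip:
  "open {u::complex. c < Im u \<and> Im u < d \<and> Re u < r}" "convex {u::complex. c < Im u \<and> Im u < d \<and> Re u < r}"
proof -
  have eq: "{u::complex. c < Im u \<and> Im u < d \<and> Re u < r} = {u. c < Im u} \<inter> {u. Im u < d} \<inter> {u. Re u < r}"
    by auto
  show "open {u::complex. c < Im u \<and> Im u < d \<and> Re u < r}"
    unfolding eq by (intro open_Int open_halfspace_Im_gt open_halfspace_Im_lt open_halfspace_Re_lt)
  show "convex {u::complex. c < Im u \<and> Im u < d \<and> Re u < r}"
    unfolding eq by (intro convex_Int convex_halfspace_Im_gt convex_halfspace_Im_lt convex_halfspace_Re_lt)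
qed

lemma continuous_on_horizontal:
  assumes "f holomorphic_on S" "\<And>t. Complex t y \<in> S"
  shows "continuous_on UNIV (\<lambda>t. f (Complex t y))"
  using assms by (intro continuous_on_compose2[OF holomorphic_on_imp_continuous_on[OF assms(1)]])
    (auto simp: Complex_eq intro!: continuous_intros)

section \<open>Principal logarithms in the right half-plane\<close>

lemma Re_pos_not_nonpos_Reals: "Re z > 0 \<Longrightarrow> z \<notin> \<real>\<^sub>\<le>\<^sub>0"
  by (auto simp: complex_nonpos_Reals_iff)

text \<open>Both arguments lie strictly between \<open>- pi / 2\<close> and \<open>pi / 2\<close>,
  so their sum does not leave the principal range.\<close>

lemma Ln_times_Re_pos:
  assumes "Re w > 0" "Re z > 0"
  shows "Ln (w * z) = Ln w + Ln z"
proof (rule Ln_times_simple)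
  show "w \<noteq> 0" "z \<noteq> 0" using assms by auto
qed (use Re_Ln_pos_lt_imp[OF assms(1)] Re_Ln_pos_lt_imp[OF assms(2)] in linarith)+

lemma Re_one_minus_exp_pos: "Re w < 0 \<Longrightarrow> Re (1 - exp w) > 0"
proof -
  assume "Re w < 0"
  then have "norm (exp w) < 1" by simp
  then show ?thesis using complex_Re_le_cmod[of "exp w"] by (simp del: norm_exp_eq_Re)
qed

lemma norm_Ln_one_minus_exp_le:
  assumes "Re w \<le> - 1"
  shows "norm (Ln (1 - exp w)) \<le> 2 * exp (Re w)"
proof -
  \<comment> \<open>Via \<open>exp 1 \<ge> (1 + 1 / 2)^2 > 2\<close>; strictness puts
    \<open>exp w\<close> inside the disc where \<open>norm_Ln_le\<close> applies.\<close>
  have "exp (- Re w) > 2"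
    using assms exp_ge_one_plus_x_over_n_power_n[of 2 1]
      exp_le_cancel_iff[of 1 "- Re w"] by (simp add: power2_eq_square del: exp_le_cancel_iff)
  then have "exp (Re w) < 1 / 2" by (simp add: exp_minus field_simps)
  then show ?thesis using norm_Ln_le[of "- exp w"] by simp
qed

section \<open>Real integrals and the sine product\<close>

text \<open>For a nonnegative integrand, monotone convergence over \<open>{- n..n}\<close> yields
  integrability together with the value.\<close>

lemma has_integral_UNIV_FTC_nonneg:
  fixes f F :: "real \<Rightarrow> real"
  assumes F: "\<And>t. (F has_real_derivative f t) (at t)" and f: "\<And>t. f t \<ge> 0"
    and bot: "(F \<longlongrightarrow> A) at_bot" and top: "(F \<longlongrightarrow> B) at_top"
  shows "(f has_integral (B - A)) UNIV"
proof (rule has_integral_monotone_convergence_increasing)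
  show "((\<lambda>t. if t \<in> {- real n..real n} then f t else 0) has_integral (F (real n) - F (- real n))) UNIV" for n
    unfolding has_integral_restrict_UNIV using F
    by (intro fundamental_theorem_of_calculus)
       (auto simp flip: has_real_derivative_iff_has_vector_derivative intro: DERIV_subset)
  show "(if t \<in> {- real n..real n} then f t else 0) \<le> (if t \<in> {- real (Suc n)..real (Suc n)} then f t else 0)" for n t
    using f by auto
  show "(\<lambda>n. if t \<in> {- real n..real n} then f t else 0) \<longlonglongrightarrow> f t" for t
  proof (rule tendsto_eventually)
    have "\<forall>\<^sub>F n in sequentially. \<bar>t\<bar> \<le> real n" by real_asymp
    then show "\<forall>\<^sub>F n in sequentially. (if t \<in> {- real n..real n} then f t else 0) = f t"
      by eventually_elim auto
  qed
  have "(\<lambda>n. F (- real n)) \<longlonglongrightarrow> A" by (rule filterlim_compose[OF bot]) real_asymp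
  moreover have "(\<lambda>n. F (real n)) \<longlonglongrightarrow> B" by (rule filterlim_compose[OF top]) real_asymp
  ultimately show "(\<lambda>n. F (real n) - F (- real n)) \<longlonglongrightarrow> B - A" by (intro tendsto_diff)
qed

text \<open>With \<open>z = exp t\<close> this is the integral of \<open>ln (1 + 1 / z^2)\<close>
  over \<open>z > 0\<close>, the contribution of the correction up to \<open>k / 2\<close>. A
  primitive is \<open>z * ln (1 + 1 / z^2) + 2 * arctan z\<close>.\<close>

lemma has_integral_ln_one_plus:
  "((\<lambda>t::real. ln (1 + exp (- 2 * t)) * exp t) has_integral pi) UNIV"
proof -
  have "((\<lambda>t::real. ln (1 + exp (- 2 * t)) * exp t) has_integral (pi - 0)) UNIV"
  proof (rule has_integral_UNIV_FTC_nonneg)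
    show "((\<lambda>t. exp t * ln (1 + exp (- 2 * t)) + 2 * arctan (exp t)) has_real_derivative ln (1 + exp (- 2 * t)) * exp t) (at t)" for t :: real
    proof -
      have p: "1 + exp (- 2 * t) > 0" by (simp add: add_pos_pos)
      have "((\<lambda>t. exp t * ln (1 + exp (- 2 * t)) + 2 * arctan (exp t)) has_real_derivative
         exp t * ln (1 + exp (- 2 * t)) + exp t * (- 2 * exp (- 2 * t) / (1 + exp (- 2 * t))) + 2 * (exp t / (1 + (exp t)\<^sup>2))) (at t)"
        using p by (auto intro!: derivative_eq_intros simp: field_class.field_divide_inverse)
      also have "(exp t)\<^sup>2 = exp (2 * t)" by (simp add: power2_eq_square flip: exp_add)
      also have "exp t * (- 2 * exp (- 2 * t) / (1 + exp (- 2 * t))) = - (2 * (exp t / (1 + exp (2 * t))))"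
        using p by (simp add: exp_minus field_simps add_pos_pos)
      finally show ?thesis by (simp add: mult.commute)
    qed
    show "ln (1 + exp (- 2 * t)) * exp t \<ge> 0" for t :: real by simp
    show "((\<lambda>t. exp t * ln (1 + exp (- 2 * t)) + 2 * arctan (exp t)) \<longlongrightarrow> 0) at_bot" by real_asymp
    show "((\<lambda>t. exp t * ln (1 + exp (- 2 * t)) + 2 * arctan (exp t)) \<longlongrightarrow> pi) at_top" by real_asymp
  qed
  then show ?thesis by simp
qed

text \<open>Substitute \<open>s = c * exp (k * t)\<close> in the Gamma integral at
  \<open>1 / k\<close>; then \<open>s powr (1 / k)\<close> is
  \<open>c powr (1 / k) * exp t\<close>.\<close>

lemma has_integral_exp_exp:
  assumes k: "k > 0" and c: "c > (0::real)"
  shows "((\<lambda>t. exp (- c * exp (k * t)) * exp t) has_integral (Gamma (1 / k) / (k * c powr (1 / k)))) UNIV"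
proof -
  define f where "f = (\<lambda>s. s powr (1 / k - 1) / exp s)"
  have "(f has_integral Gamma (1 / k)) {0..}" unfolding f_def using k by (intro Gamma_integral_real) auto
  \<comment> \<open>The endpoint 0 is dropped because the exponential substitution maps onto the
    open half-line.\<close>
  then have f: "(f has_integral Gamma (1 / k)) {0<..}"
    by (subst has_integral_spike_set_eq[of _ "{0..}"]) (auto intro: negligible_subset[of "{0}"])
  have fa: "f absolutely_integrable_on {0<..}"
    using f by (intro nonnegative_absolutely_integrable_1) (auto simp: f_def)
  have img: "(\<lambda>t. c * exp (k * t)) ` UNIV = {0<..}"
  proof safe
    fix s :: real assume "s > 0"
    then have "s = c * exp (k * (ln (s / c) / k))" using c k by simp
    then show "s \<in> range (\<lambda>t. c * exp (k * t))" by (rule range_eqI)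
  qed (use c in auto)
  have inj: "inj (\<lambda>t. c * exp (k * t))" using c k by (auto intro!: injI)
  have "(\<lambda>t. \<bar>c * (exp (k * t) * k)\<bar> * f (c * exp (k * t))) absolutely_integrable_on UNIV \<and>
     integral UNIV (\<lambda>t. \<bar>c * (exp (k * t) * k)\<bar> * f (c * exp (k * t))) = Gamma (1 / k)"
    by (subst has_absolute_integral_change_of_variables_1'[where g = "\<lambda>t. c * exp (k * t)"])
       (use f fa img inj in \<open>auto intro!: derivative_eq_intros simp: integral_unique\<close>)
  then have "((\<lambda>t. \<bar>c * (exp (k * t) * k)\<bar> * f (c * exp (k * t))) has_integral Gamma (1 / k)) UNIV"
    by (auto simp: absolutely_integrable_on_def has_integral_integral)
  also have "(\<lambda>t. \<bar>c * (exp (k * t) * k)\<bar> * f (c * exp (k * t))) = (\<lambda>t. (k * c powr (1 / k)) * (exp (- c * exp (k * t)) * exp t))"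
  proof
    fix t
    define s where "s = c * exp (k * t)"
    have s: "s > 0" using c by (simp add: s_def)
    have "\<bar>c * (exp (k * t) * k)\<bar> * f s = k * (s powr 1 * s powr (1 / k - 1)) / exp s"
      using c k s by (simp add: f_def s_def abs_mult)
    also have "s powr 1 * s powr (1 / k - 1) = s powr (1 + (1 / k - 1))" by (simp only: powr_add)
    also have "1 + (1 / k - 1) = 1 / k" by simp
    also have "s powr (1 / k) = c powr (1 / k) * exp t"
      using c k by (simp add: s_def powr_mult) (simp add: powr_def)
    finally show "\<bar>c * (exp (k * t) * k)\<bar> * f (c * exp (k * t)) = (k * c powr (1 / k)) * (exp (- c * exp (k * t)) * exp t)"
      by (simp add: s_def exp_minus field_simps)
  qed
  finally have "((\<lambda>t. (k * c powr (1 / k)) * (exp (- c * exp (k * t)) * exp t)) has_integral Gamma (1 / k)) UNIV" .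
  from has_integral_mult_right[OF this, of "inverse (k * c powr (1 / k))"] show ?thesis
    using k c by (simp add: field_simps)
qed

lemma ln_one_minus_sums:
  assumes "y > (0::real)"
  shows "(\<lambda>n. exp (- real (Suc n) * y) / real (Suc n)) sums - ln (1 - exp (- y))"
proof -
  have "(\<lambda>n. - ((- (- exp (- y))) ^ n) / real n) sums ln (1 + (- exp (- y)))"
    using assms by (intro ln_series') simp
  then have "(\<lambda>n. - (exp (- y) ^ Suc n) / real (Suc n)) sums ln (1 - exp (- y))"
    by (subst sums_Suc_iff) simp
  from sums_minus[OF this] show ?thesis
    by (simp add: exp_of_nat_mult[symmetric] del: of_nat_Suc power_Suc)
qed

lemma zeta_real_sums:
  assumes "s > (1::real)"
  shows "(\<lambda>n. 1 / real (Suc n) powr s) sums Re (zeta s)" "zeta s \<in> \<real>"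
proof -
  have "summable (\<lambda>n. real n powr (- s))" using assms by (simp add: summable_real_powr_iff)
  then have s: "summable (\<lambda>n. 1 / real (Suc n) powr s)"
    by (subst (asm) summable_Suc_iff[symmetric]) (simp add: powr_minus inverse_eq_divide)
  have "zeta s = (\<Sum>n. complex_of_real (1 / real (Suc n) powr s))"
    unfolding zeta_def by (intro arg_cong[of _ _ suminf] ext) (simp add: powr_of_real[symmetric] del: of_nat_Suc)
  also have "\<dots> = of_real (\<Sum>n. 1 / real (Suc n) powr s)"
    by (rule suminf_of_real[OF s, symmetric])
  finally have z: "zeta s = of_real (\<Sum>n. 1 / real (Suc n) powr s)" .
  show "zeta s \<in> \<real>" unfolding z by simp
  show "(\<lambda>n. 1 / real (Suc n) powr s) sums Re (zeta s)" unfolding z using s by (simp add: summable_sums)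
qed

text \<open>Expand the logarithm in exponentials. In the term with index \<open>n\<close> (counted
  from 1) the series gives a factor \<open>1 / n\<close> and the integral a factor
  \<open>n powr (- 1 / k)\<close>, which together form the series of \<open>zeta\<close> at
  \<open>1 + 1 / k\<close>. All terms are positive, so monotone convergence applies.\<close>

lemma has_integral_ln_one_minus_exp_exp:
  assumes k: "k > 0"
  shows "((\<lambda>t::real. - ln (1 - exp (- exp (k * t))) * exp t) has_integral (Gamma (1 / k) / k * Re (zeta (of_real (1 + 1 / k))))) UNIV"
proof (rule has_integral_monotone_convergence_increasing)
  define f where "f = (\<lambda>n t. exp (- real (Suc n) * exp (k * t)) / real (Suc n) * exp t)"
  show "((\<lambda>t. \<Sum>n<N. f n t) has_integral (\<Sum>n<N. Gamma (1 / k) / k * (1 / real (Suc n) powr (1 + 1 / k)))) UNIV" for N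
  proof (intro has_integral_sum)
    fix n
    from has_integral_mult_right[OF has_integral_exp_exp[OF k, of "real (Suc n)"], of "1 / real (Suc n)"]
    show "(f n has_integral (Gamma (1 / k) / k * (1 / real (Suc n) powr (1 + 1 / k)))) UNIV"
      by (simp add: f_def powr_add mult_ac del: of_nat_Suc)
  qed auto
  show "(\<Sum>n<N. f n t) \<le> (\<Sum>n<Suc N. f n t)" for N t by (simp add: f_def)
  have "(\<lambda>n. f n t) sums (- ln (1 - exp (- exp (k * t))) * exp t)" for t
    unfolding f_def by (intro sums_mult2 ln_one_minus_sums) simp
  then show "(\<lambda>N. \<Sum>n<N. f n t) \<longlonglongrightarrow> - ln (1 - exp (- exp (k * t))) * exp t" for t
    by (simp add: sums_def)
  have "(\<lambda>n. Gamma (1 / k) / k * (1 / real (Suc n) powr (1 + 1 / k))) sums (Gamma (1 / k) / k * Re (zeta (of_real (1 + 1 / k))))"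
    using k by (intro sums_mult zeta_real_sums) auto
  then show "(\<lambda>N. \<Sum>n<N. Gamma (1 / k) / k * (1 / real (Suc n) powr (1 + 1 / k))) \<longlonglongrightarrow> Gamma (1 / k) / k * Re (zeta (of_real (1 + 1 / k)))"
    by (simp add: sums_def)
qed

text \<open>The logarithm of Euler's sine product at the imaginary point
  \<open>\<i> * l\<close>.\<close>

lemma sum_ln_sinh_limit:
  assumes l: "l > (0::real)"
  shows "(\<lambda>n. \<Sum>d=1..n. ln (1 + (l / real d)\<^sup>2)) \<longlonglongrightarrow> ln (sinh (pi * l) / (pi * l))"
proof -
  have "(\<lambda>n. of_real pi * (\<i> * l) * (\<Prod>d=1..n. 1 - (\<i> * l)\<^sup>2 / of_nat d ^ 2)) \<longlonglongrightarrow> sin (of_real pi * (\<i> * l))"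
    by (rule sin_product_formula_complex)
  also have "(\<lambda>n. of_real pi * (\<i> * l) * (\<Prod>d=1..n. 1 - (\<i> * l)\<^sup>2 / of_nat d ^ 2))
     = (\<lambda>n. \<i> * of_real (pi * l * (\<Prod>d=1..n. 1 + (l / real d)\<^sup>2)))"
    by (auto simp: power_mult_distrib power_divide)
  also have "sin (of_real pi * (\<i> * l)) = \<i> * of_real (sinh (pi * l))"
    using sin_i_times[of "of_real (pi * l)"] by (simp add: sinh_field_def mult_ac exp_minus flip: exp_of_real)
  finally have "(\<lambda>n. Im (\<i> * of_real (pi * l * (\<Prod>d=1..n. 1 + (l / real d)\<^sup>2)))) \<longlonglongrightarrow> Im (\<i> * of_real (sinh (pi * l)))"
    by (rule tendsto_Im)
  then have "(\<lambda>n. pi * l * (\<Prod>d=1..n. 1 + (l / real d)\<^sup>2)) \<longlonglongrightarrow> sinh (pi * l)"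
    by (simp only: Im_i_times Re_complex_of_real)
  from tendsto_divide[OF this tendsto_const[of "pi * l"]]
  have "(\<lambda>n. \<Prod>d=1..n. 1 + (l / real d)\<^sup>2) \<longlonglongrightarrow> sinh (pi * l) / (pi * l)" using l by simp
  then have "(\<lambda>n. ln (\<Prod>d=1..n. 1 + (l / real d)\<^sup>2)) \<longlonglongrightarrow> ln (sinh (pi * l) / (pi * l))"
    using l by (intro tendsto_ln) auto
  moreover have "ln (\<Prod>d=1..n. 1 + (l / real d)\<^sup>2) = (\<Sum>d=1..n. ln (1 + (l / real d)\<^sup>2))" for n
    by (intro ln_prod) (simp, smt (verit) zero_le_power2)
  ultimately show ?thesis by simp
qed

section \<open>Regrouping the double series\<close>

text \<open>Every term of the double family is nonnegative, so convergence of the iterated sum over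
  \<open>d\<close> gives unconditional summability, and the pairs may be regrouped by
  \<open>n\<close>.\<close>

lemma D_exp_sums:
  assumes k: "k \<ge> 1" and x: "x > 0"
    and Y: "(\<lambda>d. - ln (1 - exp (- (real (Suc d) ^ k * x)))) sums Y"
  shows "(\<lambda>n. D k (- 1) (Suc n) * exp (- real (Suc n) * x)) sums Y"
proof -
  define f where "f = (\<lambda>(d::nat, m::nat). exp (- real m * (real d ^ k * x)) / real m)"
  have inner: "((\<lambda>m. f (d, m)) has_sum - ln (1 - exp (- (real d ^ k * x)))) {1..}" if "d \<in> {1..}" for d
  proof -
    have "real d ^ k * x > 0" using that x by simp
    from ln_one_minus_sums[OF this]
    have "(\<lambda>n. f (d, Suc n)) sums - ln (1 - exp (- (real d ^ k * x)))" by (simp add: f_def del: of_nat_Suc)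
    then have "((\<lambda>n. f (d, Suc n)) has_sum - ln (1 - exp (- (real d ^ k * x)))) UNIV"
      by (rule sums_nonneg_imp_has_sum) (simp add: f_def)
    then show ?thesis
      by (subst (asm) has_sum_reindex_bij_witness[of UNIV "\<lambda>n. n - 1" Suc "{1..}"]) auto
  qed
  have "((\<lambda>d. - ln (1 - exp (- (real (Suc d) ^ k * x)))) has_sum Y) UNIV"
    using x by (intro sums_nonneg_imp_has_sum[OF Y]) (auto simp: ln_le_zero_iff)
  then have outer: "((\<lambda>d. - ln (1 - exp (- (real d ^ k * x)))) has_sum Y) {1..}"
    by (subst (asm) has_sum_reindex_bij_witness[of UNIV "\<lambda>n. n - 1" Suc "{1..}"]) auto
  have "f summable_on Sigma {1..} (\<lambda>_. {1..})"
    by (rule summable_on_SigmaI[OF inner]) (use outer in \<open>auto simp: summable_on_def f_def\<close>)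
  then have "(f has_sum Y) (Sigma {1..} (\<lambda>_. {1..}))"
    by (intro has_sum_SigmaI[OF inner outer]) auto
  \<comment> \<open>The pair \<open>(d, m)\<close> becomes \<open>(m * d ^ k, d)\<close>; since
    \<open>d ^ k\<close> divides \<open>n\<close>, the quotient \<open>n div d ^ k\<close> recovers
    \<open>m\<close> exactly.\<close>
  then have "((\<lambda>(n, d). f (d, n div d ^ k)) has_sum Y) (Sigma {1..} (\<lambda>n. {d. 1 \<le> d \<and> d ^ k dvd n}))"
    by (subst has_sum_reindex_bij_witness[where i = "\<lambda>(d, m). (m * d ^ k, d)" and j = "\<lambda>(n, d). (d, n div d ^ k)"
        and T = "Sigma {1..} (\<lambda>_. {1..})" and h = f and s' = Y])
       (auto simp: Suc_le_eq div_greater_zero_iff dvd_imp_le)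
  moreover have "((\<lambda>d. case (n, d) of (n, d) \<Rightarrow> f (d, n div d ^ k)) has_sum (D k (- 1) n * exp (- real n * x))) {d. 1 \<le> d \<and> d ^ k dvd n}" if "n \<in> {1..}" for n
  proof -
    have "{d. 1 \<le> d \<and> d ^ k dvd n} \<subseteq> {..n}"
    proof
      fix d assume "d \<in> {d. 1 \<le> d \<and> d ^ k dvd n}"
      then have "d \<le> d ^ k" "d ^ k \<le> n" using that k by (auto intro: self_le_power dvd_imp_le)
      then show "d \<in> {..n}" by simp
    qed
    then have fin: "finite {d. 1 \<le> d \<and> d ^ k dvd n}" by (rule finite_subset) simp
    have "f (d, n div d ^ k) = (real n / real d ^ k) powi (- 1) * exp (- real n * x)" if d: "1 \<le> d" "d ^ k dvd n" for d
    proof -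
      obtain m where m: "n = d ^ k * m" using d by blast
      then show ?thesis using d by (simp add: f_def power_int_minus field_simps)
    qed
    then have "(\<Sum>d | 1 \<le> d \<and> d ^ k dvd n. f (d, n div d ^ k)) = D k (- 1) n * exp (- real n * x)"
      unfolding D_def sum_distrib_right by (intro sum.cong) auto
    then show ?thesis using has_sum_finite[OF fin, of "\<lambda>d. f (d, n div d ^ k)"] by simp
  qed
  ultimately have "((\<lambda>n. D k (- 1) n * exp (- real n * x)) has_sum Y) {1..}"
    by (rule has_sum_SigmaD)
  then have "((\<lambda>n. D k (- 1) (Suc n) * exp (- real (Suc n) * x)) has_sum Y) UNIV"
    by (subst has_sum_reindex_bij_witness[of UNIV "\<lambda>n. n - 1" Suc "{1..}"]) (auto simp del: of_nat_Suc)
  then show ?thesis by (rule has_sum_imp_sums)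
qed

lemma index_set_bounds:
  assumes "j \<in> index_set k" "k > 0"
  shows "\<bar>j\<bar> < int k"
  using assms by (auto simp: index_set_def)

lemma finite_index_set [simp]: "finite (index_set k)"
  by (rule finite_subset[of _ "{- (int k - 1)..int k - 1}"]) (auto simp: index_set_def)

section \<open>The summand, its derivative and the summation kernel\<close>

text \<open>In the application $l = x^{-1/k}$.\<close>
locale even_lambert =
  fixes k :: nat and l :: real
  assumes k2: "k \<ge> 2" and k_even: "even k" and l_pos: "l > 0"
begin

text \<open>Half of \<open>pi / (2 * k)\<close>, the angle at which the branch points of the summand
  begin. The open strip of half-width \<open>2 * theta\<close> thus surrounds the closed one on
  whose edges the integrals are taken.\<close>

definition theta :: real where "theta = pi / (4 * k)"

text \<open>Everything is written in the coordinate $u = \log z$: \<^term>\<open>Ht\<close> is the regularized summand with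
  derivative \<^term>\<open>dHt\<close>, and \<^term>\<open>Lt\<close> is a primitive of the kernel \<^term>\<open>dLt\<close>, whose poles
  $u = \log (d/l)$ have residue 1. The angle \<^term>\<open>theta\<close> keeps \<^term>\<open>exp (of_nat k * u)\<close> in the
  right half-plane.\<close>

definition Ht :: "complex \<Rightarrow> complex" where
  "Ht u = - Ln (1 - exp (- exp (of_nat k * u))) - of_nat k / 2 * Ln (1 + exp (- 2 * u))"

definition dHt :: "complex \<Rightarrow> complex" where
  "dHt u = of_nat k * (1 / (1 + exp (2 * u)) - bern (exp (of_nat k * u)))"

definition Lt :: "complex \<Rightarrow> complex" where
  "Lt u = Ln (1 - exp (2 * pi * \<i> * l * exp u))"

definition dLt :: "complex \<Rightarrow> complex" where
  "dLt u = bern (- (2 * pi * \<i> * l * exp u))"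

lemma theta_pos: "theta > 0" and theta_le: "theta \<le> pi / 8" and k_theta: "k * theta = pi / 4"
  using pi_gt_zero k2 by (auto simp: theta_def divide_le_eq intro!: frac_le)

lemma Re_exp_k: "Re (exp (of_nat k * u)) = exp (k * Re u) * cos (k * Im u)"
  and norm_exp_k: "norm (exp (of_nat k * u)) = exp (k * Re u)"
  by (auto simp: Re_exp)

lemma Re_exp_k_pos:
  assumes "\<bar>Im u\<bar> < 2 * theta"
  shows "Re (exp (of_nat k * u)) > 0"
proof -
  have "\<bar>k * Im u\<bar> < k * (2 * theta)" using assms k2 by (simp add: abs_mult)
  then have "\<bar>k * Im u\<bar> < pi / 2" using k_theta by simp
  then show ?thesis by (auto simp: Re_exp_k abs_less_iff intro!: cos_gt_zero_pi mult_pos_pos simp del: zero_less_mult_iff)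
qed

text \<open>The exponent 2 instead of \<open>k\<close> is the decay rate of the second logarithm in
  \<open>Ht\<close>, so both logarithms end up with the same bound.\<close>

lemma Re_exp_k_ge:
  assumes "\<bar>Im u\<bar> \<le> theta" "Re u \<ge> 0"
  shows "Re (exp (of_nat k * u)) \<ge> exp (2 * Re u) / 2"
proof -
  have "\<bar>k * Im u\<bar> \<le> k * theta" unfolding abs_mult using assms k2 by (intro mult_mono) auto
  then have "\<bar>k * Im u\<bar> \<le> pi / 3" using k_theta by simp
  then have "cos \<bar>k * Im u\<bar> \<ge> cos (pi / 3)" by (intro cos_monotone_0_pi_le) auto
  then have c: "cos (k * Im u) \<ge> 1 / 2" by (simp add: cos_60)
  have "exp (2 * Re u) * (1 / 2) \<le> exp (k * Re u) * cos (k * Im u)"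
    using c k2 assms by (intro mult_mono) (auto intro: mult_right_mono)
  then show ?thesis by (simp add: Re_exp_k)
qed

lemma Re_one_plus_exp_pos:
  assumes "\<bar>Im u\<bar> < 2 * theta"
  shows "Re (1 + exp (- 2 * u)) > 0"
proof -
  have "cos (2 * Im u) \<ge> 0" using assms theta_le by (intro cos_ge_zero) linarith+
  then have "Re (exp (- 2 * u)) \<ge> 0" by (simp add: Re_exp)
  then show ?thesis by simp
qed

lemma Ht_deriv:
  assumes "\<bar>Im u\<bar> < 2 * theta"
  shows "(Ht has_field_derivative dHt u) (at u)"
proof -
  define w where "w = exp (of_nat k * u)"
  have w: "Re w > 0" using Re_exp_k_pos[OF assms] by (simp add: w_def)
  have d1: "1 - exp (- w) \<notin> \<real>\<^sub>\<le>\<^sub>0" using w by (intro Re_pos_not_nonpos_Reals Re_one_minus_exp_pos) simp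
  have d2: "1 + exp (- 2 * u) \<notin> \<real>\<^sub>\<le>\<^sub>0" using Re_one_plus_exp_pos[OF assms] by (intro Re_pos_not_nonpos_Reals)
  have "norm (exp w) \<noteq> 1" using w by simp
  then have n1: "exp w \<noteq> 1" by force
  have n2: "1 + exp (- 2 * u) \<noteq> 0" using d2 by auto
  then have n3: "1 + exp (2 * u) \<noteq> 0" by (simp add: exp_minus field_simps)
  have "((\<lambda>u. Ln (1 - exp (- exp (of_nat k * u)))) has_field_derivative exp (- w) * (w * k) / (1 - exp (- w))) (at u)"
    using d1 unfolding w_def by (auto intro!: derivative_eq_intros simp: field_class.field_divide_inverse)
  moreover have "((\<lambda>u. Ln (1 + exp (- 2 * u))) has_field_derivative - 2 * exp (- 2 * u) / (1 + exp (- 2 * u))) (at u)"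
    using d2 by (auto intro!: derivative_eq_intros simp: field_class.field_divide_inverse)
  ultimately have "(Ht has_field_derivative - (exp (- w) * (w * k) / (1 - exp (- w)))
      - of_nat k / 2 * (- 2 * exp (- 2 * u) / (1 + exp (- 2 * u)))) (at u)"
    unfolding Ht_def by (intro DERIV_diff DERIV_minus DERIV_cmult)
  also have "- (exp (- w) * (w * k) / (1 - exp (- w))) - of_nat k / 2 * (- 2 * exp (- 2 * u) / (1 + exp (- 2 * u)))
      = - (exp (- w) * (w * k) / (1 - exp (- w))) + k * exp (- 2 * u) / (1 + exp (- 2 * u))"
    by simp
  also have "exp (- w) * (w * k) / (1 - exp (- w)) = k * bern w"
    using n1 by (simp add: bern_def exp_minus field_simps)
  also have "k * exp (- 2 * u) / (1 + exp (- 2 * u)) = k / (1 + exp (2 * u))"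
    using n2 n3 by (simp add: exp_minus field_simps)
  also have "- (k * bern w) + k / (1 + exp (2 * u)) = dHt u"
    by (simp add: dHt_def w_def algebra_simps)
  finally show ?thesis .
qed

text \<open>In the upper half-plane \<open>2 * pi * \<i> * l * exp u\<close> has negative real part,
  so the logarithm never meets its cut. Unlike \<open>Ht\<close>, its primitive counterpart
  \<open>Lt\<close> therefore lives on the full strip \<open>0 < Im u < pi\<close>.\<close>

lemma Lt_deriv:
  assumes "0 < Im u" "Im u < pi"
  shows "(Lt has_field_derivative dLt u) (at u)"
proof -
  define v where "v = 2 * pi * \<i> * l * exp u"
  have v: "Re v < 0" using assms l_pos by (simp add: v_def Im_exp sin_gt_zero)
  have d1: "1 - exp v \<notin> \<real>\<^sub>\<le>\<^sub>0" using v by (intro Re_pos_not_nonpos_Reals Re_one_minus_exp_pos) 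
  then have n1: "exp v \<noteq> 1" by auto
  have "(Lt has_field_derivative (- (exp v * v) / (1 - exp v))) (at u)"
    unfolding Lt_def using d1 unfolding v_def
    by (auto intro!: derivative_eq_intros simp: field_class.field_divide_inverse)
  also have "- (exp v * v) / (1 - exp v) = dLt u"
    using n1 unfolding dLt_def v_def[symmetric] by (simp add: bern_def exp_minus field_simps)
  finally show ?thesis .
qed

section \<open>Growth at the two ends of the strips\<close>

lemma norm_Ht_top:
  assumes "\<bar>Im u\<bar> \<le> theta" "Re u \<ge> 1"
  shows "norm (Ht u) \<le> (4 + k) * exp (- 2 * Re u)"
proof -
  define w where "w = exp (of_nat k * u)"
  have e: "exp (2 * Re u) \<ge> 3" using assms exp_ge_add_one_self[of "2 * Re u"] by linarith
  have w: "Re w \<ge> exp (2 * Re u) / 2" using Re_exp_k_ge[of u] assms by (simp add: w_def)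
  \<comment> \<open>Double exponential decay is traded for the rate \<open>exp (- 2 * Re u)\<close>
    by \<open>exp (- y) \<le> 1 / y\<close>.\<close>
  have "exp (- Re w) \<le> 1 / Re w"
    using exp_ge_add_one_self[of "Re w"] w e unfolding exp_minus inverse_eq_divide by (intro divide_left_mono mult_pos_pos) (linarith, simp, simp, linarith)
  also have "\<dots> \<le> 1 / (exp (2 * Re u) / 2)" using w by (intro frac_le) auto
  finally have "exp (- Re w) \<le> 2 * exp (- 2 * Re u)" by (simp add: exp_minus field_simps)
  moreover have "norm (Ln (1 - exp (- w))) \<le> 2 * exp (- Re w)"
    using norm_Ln_one_minus_exp_le[of "- w"] w e by simp
  ultimately have A: "norm (Ln (1 - exp (- w))) \<le> 4 * exp (- 2 * Re u)" by simp
  have "norm (exp (- 2 * u)) = 1 / exp (2 * Re u)" by (simp add: exp_minus inverse_eq_divide norm_divide)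
  also have "\<dots> < 1 / 2" using e by (simp add: field_simps)
  finally have "norm (exp (- 2 * u)) < 1 / 2" .
  then have B: "norm (Ln (1 + exp (- 2 * u))) \<le> 2 * exp (- 2 * Re u)"
    using norm_Ln_le[of "exp (- 2 * u)"] by simp
  have "norm (Ht u) \<le> norm (Ln (1 - exp (- w))) + norm (of_nat k / 2 * Ln (1 + exp (- 2 * u)))"
    unfolding Ht_def w_def[symmetric] using norm_triangle_ineq4[of "- Ln (1 - exp (- w))" "of_nat k / 2 * Ln (1 + exp (- 2 * u))"] by simp
  also have "norm (of_nat k / 2 * Ln (1 + exp (- 2 * u))) = k / 2 * norm (Ln (1 + exp (- 2 * u)))"
    by (simp add: norm_mult norm_divide)
  also have "\<dots> \<le> k / 2 * (2 * exp (- 2 * Re u))" using B by (intro mult_left_mono) auto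
  finally show ?thesis using A by (simp add: algebra_simps)
qed

lemma exp_k_le:
  fixes t :: real
  assumes "t \<le> 0"
  shows "exp (k * t) \<le> exp (2 * t)"
proof -
  have "k * t \<le> 2 * t" using assms k2 by (intro mult_right_mono_neg) auto
  then show ?thesis by simp
qed

text \<open>The value \<open>1 / 7\<close> is below the radius \<open>1 / 6\<close> of the estimates
  for \<open>bern\<close>, and \<open>3 / 7 < 1 / 2\<close> admits the logarithm bound.\<close>

lemma exp_2_small:
  assumes "t \<le> -3"
  shows "exp (2 * t) \<le> (1 / 7 :: real)"
proof -
  have "exp (- (2 * t)) \<ge> 7" using assms exp_ge_add_one_self[of "- (2 * t)"] by linarith
  then show ?thesis by (simp add: exp_minus field_simps)
qed

text \<open>As $\mathrm{Re}\,u \to -\infty$ the linearly growing parts of the two logarithms in \<^term>\<open>Ht\<close> cancel.\<close>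
lemma norm_Ht_bot:
  assumes "\<bar>Im u\<bar> \<le> theta" "Re u \<le> - 3"
  shows "norm (Ht u) \<le> (6 + k) * exp (2 * Re u)"
proof -
  \<comment> \<open>\<open>q\<close> is \<open>1 - exp (- w)\<close> with its zero at
    \<open>w = 0\<close> divided out; the factor \<open>w\<close> has logarithm exactly
    \<open>of_nat k * u\<close>.\<close>
  define w q where "w = exp (of_nat k * u)" and "q = (1 - exp (- w)) / w"
  have w0: "w \<noteq> 0" by (simp add: w_def)
  have nw: "norm w \<le> exp (2 * Re u)" using exp_k_le[of "Re u"] assms by (simp add: w_def)
  have e: "exp (2 * Re u) \<le> 1 / 7" using exp_2_small assms by simp
  have "norm (q - 1) = norm (exp (- w) - 1 - (- w)) / norm w"
    using w0 by (simp add: q_def field_simps norm_minus_commute flip: norm_divide)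
  also have "\<dots> \<le> 3 * norm w ^ 2 / norm w"
    using norm_exp_minus_1_minus_le[of "- w"] nw e by (intro divide_right_mono) auto
  also have "\<dots> = 3 * norm w" using w0 by (simp add: power2_eq_square)
  finally have q1: "norm (q - 1) \<le> 3 * norm w" .
  then have q2: "norm (q - 1) < 1 / 2" using nw e by linarith
  have q3: "Re q > 0" using q2 abs_Re_le_cmod[of "q - 1"] by auto
  have Lnw: "Ln w = of_nat k * u"
  proof -
    have "\<bar>k * Im u\<bar> \<le> k * theta" unfolding abs_mult using assms k2 by (intro mult_mono) auto
    then have "\<bar>k * Im u\<bar> < pi" using k_theta pi_gt_zero by linarith
    then show ?thesis unfolding w_def by (intro Ln_exp) auto
  qed
  have wpos: "Re w > 0" using Re_exp_k_pos[of u] assms theta_pos by (simp add: w_def)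
  have A: "Ln (1 - exp (- w)) = Ln q + of_nat k * u"
  proof -
    have "Ln (q * w) = Ln q + Ln w"
      using q3 wpos w0 by (intro Ln_times_Re_pos) auto
    then show ?thesis using w0 Lnw by (simp add: q_def)
  qed
  have r2: "norm (exp (2 * u)) < 1 / 2" using e by simp
  have r3: "Re (1 + exp (2 * u)) > 0" using r2 abs_Re_le_cmod[of "exp (2 * u)"] by auto
  have B: "Ln (1 + exp (- 2 * u)) = Ln (1 + exp (2 * u)) - 2 * u"
  proof -
    have "Ln (exp (- 2 * u)) = - 2 * u"
      using assms theta_le pi_gt_zero by (intro Ln_exp; simp; linarith)
    moreover have "Re (exp (- 2 * u)) > 0"
    proof -
      have "cos (2 * Im u) > 0"
        using assms theta_le pi_gt_zero by (intro cos_gt_zero_pi; linarith)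
      then show ?thesis by (simp add: Re_exp)
    qed
    ultimately have "Ln ((1 + exp (2 * u)) * exp (- 2 * u)) = Ln (1 + exp (2 * u)) + (- 2 * u)"
      using r3 Ln_times_Re_pos[of "1 + exp (2 * u)" "exp (- 2 * u)"] by simp
    then show ?thesis by (simp add: ring_distribs exp_minus add.commute)
  qed
  have "Ht u = - Ln q - of_nat k / 2 * Ln (1 + exp (2 * u))"
    unfolding Ht_def w_def[symmetric] A B by (simp add: algebra_simps)
  then have "norm (Ht u) \<le> norm (Ln q) + norm (of_nat k / 2 * Ln (1 + exp (2 * u)))"
    using norm_triangle_ineq4[of "- Ln q" "of_nat k / 2 * Ln (1 + exp (2 * u))"] by simp
  also have "norm (of_nat k / 2 * Ln (1 + exp (2 * u))) = k / 2 * norm (Ln (1 + exp (2 * u)))"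
    by (simp add: norm_mult norm_divide)
  also have "\<dots> \<le> k / 2 * (2 * exp (2 * Re u))"
    using norm_Ln_le[OF r2] by (intro mult_left_mono) auto
  also have "norm (Ln q) \<le> 6 * exp (2 * Re u)"
    using norm_Ln_le[of "q - 1"] q1 q2 nw by simp
  finally show ?thesis by (simp add: algebra_simps)
qed

text \<open>Both fractions in \<open>dHt\<close> tend to 1, with errors
  \<open>2 * exp (2 * Re u)\<close> and \<open>6 * exp (2 * Re u)\<close>. There is no restriction
  on \<open>Im u\<close>, since the bound has to serve the whole upper sector.\<close>

lemma norm_dHt_bot:
  assumes "Re u \<le> - 3"
  shows "norm (dHt u) \<le> 8 * k * exp (2 * Re u)"
proof -
  define w where "w = exp (of_nat k * u)"
  have w0: "w \<noteq> 0" by (simp add: w_def)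
  have nw: "norm w \<le> exp (2 * Re u)" using exp_k_le[of "Re u"] assms by (simp add: w_def)
  have e: "exp (2 * Re u) \<le> 1 / 7" using exp_2_small assms by simp
  have d: "norm (1 + exp (2 * u)) \<ge> 1 / 2" using norm_triangle_ineq2[of 1 "- exp (2 * u)"] e by simp
  then have "1 + exp (2 * u) \<noteq> 0" by auto
  then have "1 / (1 + exp (2 * u)) - 1 = - exp (2 * u) / (1 + exp (2 * u))" by (simp add: field_simps)
  then have "norm (1 / (1 + exp (2 * u)) - 1) = exp (2 * Re u) / norm (1 + exp (2 * u))"
    by (simp add: norm_divide)
  also have "\<dots> \<le> exp (2 * Re u) / (1 / 2)" using d by (intro divide_left_mono) auto
  finally have A: "norm (1 / (1 + exp (2 * u)) - 1) \<le> 2 * exp (2 * Re u)" by simp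
  have B: "norm (bern w - 1) \<le> 6 * exp (2 * Re u)"
    using norm_bern_minus_1_le[of w] w0 nw e by linarith
  have "dHt u = of_nat k * ((1 / (1 + exp (2 * u)) - 1) - (bern w - 1))" by (simp add: dHt_def w_def)
  then have "norm (dHt u) = k * norm ((1 / (1 + exp (2 * u)) - 1) - (bern w - 1))" by (simp add: norm_mult)
  also have "\<dots> \<le> k * (2 * exp (2 * Re u) + 6 * exp (2 * Re u))"
    using norm_triangle_ineq4[of "1 / (1 + exp (2 * u)) - 1" "bern w - 1"] A B
    by (intro mult_left_mono) auto
  finally show ?thesis by (simp add: algebra_simps)
qed

text \<open>The bound on \<open>bern\<close> is a hypothesis because it has two sources: the radius
  halfway between poles on vertical edges, and the right half-plane on horizontal lines.\<close>

lemma norm_dHt_top: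
  assumes "Re u \<ge> 1" and b: "norm (bern (exp (of_nat k * u))) \<le> 2 * norm (exp (of_nat k * u))"
  shows "norm (dHt u) \<le> k * (1 + 2 * exp (k * Re u))"
proof -
  have e: "exp (2 * Re u) \<ge> 3" using assms exp_ge_add_one_self[of "2 * Re u"] by linarith
  have d: "norm (1 + exp (2 * u)) \<ge> 1" using norm_triangle_ineq2[of "exp (2 * u)" "- 1"] e by (simp add: add.commute)
  then have A: "norm (1 / (1 + exp (2 * u))) \<le> 1" by (simp add: norm_divide divide_le_eq_1)
  have "norm (dHt u) = k * norm (1 / (1 + exp (2 * u)) - bern (exp (of_nat k * u)))" by (simp add: dHt_def norm_mult)
  also have "\<dots> \<le> k * (1 + 2 * exp (k * Re u))"
    using norm_triangle_ineq4[of "1 / (1 + exp (2 * u))" "bern (exp (of_nat k * u))"] A b norm_exp_k[of u]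
    by (intro mult_left_mono) auto
  finally show ?thesis .
qed

lemma norm_dHt_top_circle:
  assumes "Re u \<ge> 1" "exp (k * Re u) = 2 * pi * (real n + 1 / 2)"
  shows "norm (dHt u) \<le> k * (1 + 2 * exp (k * Re u))"
  using assms norm_bern_le_circle[of "exp (of_nat k * u)" n] norm_exp_k[of u] by (intro norm_dHt_top) auto

lemma norm_dHt_top_line:
  assumes "Re u \<ge> 1" "\<bar>Im u\<bar> \<le> theta"
  shows "norm (dHt u) \<le> k * (1 + 2 * exp (k * Re u))"
proof (rule norm_dHt_top[OF assms(1)])
  have "exp (2 * Re u) \<ge> 3" using assms exp_ge_add_one_self[of "2 * Re u"] by linarith
  then have w: "Re (exp (of_nat k * u)) \<ge> 1" using Re_exp_k_ge[of u] assms by linarith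
  have "norm (bern (exp (of_nat k * u))) \<le> 2 * norm (exp (of_nat k * u)) * exp (- Re (exp (of_nat k * u)))"
    by (rule norm_bern_le_right[OF w])
  also have "\<dots> \<le> 2 * norm (exp (of_nat k * u)) * 1"
    using w by (intro mult_left_mono) auto
  finally show "norm (bern (exp (of_nat k * u))) \<le> 2 * norm (exp (of_nat k * u))" by simp
qed

text \<open>The smallest value of \<open>2 * pi * l * sin (Im u)\<close> for
  \<open>theta \<le> Im u \<le> pi - theta\<close>, hence the decay rate of \<open>Lt\<close> in the
  upper sector.\<close>

definition c0 :: real where "c0 = 2 * pi * l * sin theta"

lemma c0_pos: "c0 > 0"
  using l_pos theta_pos theta_le by (auto simp: c0_def intro!: mult_pos_pos sin_gt_zero)

lemma norm_Lt_top:
  assumes "Im u \<in> {theta..pi - theta}" "c0 * exp (Re u) \<ge> 1"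
  shows "norm (Lt u) \<le> 2 * exp (- (c0 * exp (Re u)))"
proof -
  have "sin theta \<le> sin (Im u)"
  proof (cases "Im u \<le> pi / 2")
    case True
    then show ?thesis using assms theta_pos by (intro sin_monotone_2pi_le) auto
  next
    case False
    then have "sin theta \<le> sin (pi - Im u)" using assms theta_pos by (intro sin_monotone_2pi_le) auto
    then show ?thesis by simp
  qed
  then have "2 * pi * l * exp (Re u) * sin theta \<le> 2 * pi * l * exp (Re u) * sin (Im u)"
    using l_pos by (intro mult_left_mono) auto
  then have v: "Re (2 * pi * \<i> * l * exp u) \<le> - (c0 * exp (Re u))"
    by (simp add: Im_exp c0_def algebra_simps)
  then have "norm (Lt u) \<le> 2 * exp (Re (2 * pi * \<i> * l * exp u))"
    unfolding Lt_def using assms by (intro norm_Ln_one_minus_exp_le) linarith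
  also have "\<dots> \<le> 2 * exp (- (c0 * exp (Re u)))" using v by simp
  finally show ?thesis .
qed

text \<open>The true growth is linear in \<open>Re u\<close>, from the logarithmic zero at
  \<open>z = 0\<close>. The cruder \<open>exp (- Re u)\<close> suffices against the factor
  \<open>exp (2 * Re u)\<close> from \<open>Ht\<close> or \<open>dHt\<close>.\<close>

lemma norm_Lt_bot:
  assumes "2 * pi * l * exp (Re u) \<le> 1 / 6" "Re u \<le> 0"
  shows "norm (Lt u) \<le> (1 + pi + \<bar>ln (pi * l)\<bar>) * exp (- Re u)"
proof -
  define v where "v = 2 * pi * \<i> * l * exp u"
  have nv: "norm v = 2 * pi * l * exp (Re u)" using l_pos by (simp add: v_def norm_mult)
  have nv6: "norm v \<le> 1 / 6" using assms nv by simp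
  define z where "z = 1 - exp v"
  have z: "z = - (exp v - 1)" by (simp add: z_def)
  have lo: "norm z \<ge> pi * l * exp (Re u)"
    unfolding z norm_minus_cancel using norm_exp_minus_1_ge_small[of v] assms nv by simp
  have zpos: "norm z > 0" using lo l_pos by (smt (verit) exp_gt_zero mult_pos_pos pi_gt_zero)
  have "norm (exp v - 1) \<le> norm (exp v - 1 - v) + norm v" 
    using norm_triangle_ineq[of "exp v - 1 - v" v] by simp
  also have "\<dots> \<le> 3 * norm v * norm v + norm v"
    using norm_exp_minus_1_minus_le[of v] nv assms by (simp add: power2_eq_square)
  also have "\<dots> \<le> 3 * (1 / 6) * (1 / 6) + 1 / 6" using nv6 by (intro add_mono mult_mono) auto
  finally have hi: "norm z \<le> 1" by (simp add: z norm_minus_commute)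
  have "ln (norm z) \<ge> ln (pi * l * exp (Re u))" using lo zpos l_pos by simp
  then have ln: "\<bar>ln (norm z)\<bar> \<le> \<bar>ln (pi * l)\<bar> - Re u" using hi zpos l_pos by (simp add: ln_mult)
  \<comment> \<open>The principal branch bounds the imaginary part by \<open>pi\<close>, so only
    \<open>ln (norm z)\<close> can grow; as \<open>norm z \<le> 1\<close>, the lower bound
    \<open>lo\<close> controls it.\<close>
  have "norm (Ln z) \<le> \<bar>Re (Ln z)\<bar> + \<bar>Im (Ln z)\<bar>" by (rule cmod_le)
  also have "\<dots> \<le> \<bar>ln (norm z)\<bar> + pi"
    using zpos mpi_less_Im_Ln[of z] Im_Ln_le_pi[of z] by auto
  also have "\<dots> \<le> (pi + \<bar>ln (pi * l)\<bar>) * 1 + (- Re u)" using ln by simp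
  also have "\<dots> \<le> (pi + \<bar>ln (pi * l)\<bar>) * exp (- Re u) + exp (- Re u)"
    using assms exp_ge_add_one_self[of "- Re u"] by (intro add_mono mult_left_mono) auto
  finally show ?thesis by (simp add: Lt_def z_def v_def algebra_simps)
qed

lemma norm_dLt_bot:
  assumes "2 * pi * l * exp (Re u) \<le> 1 / 6"
  shows "norm (dLt u) \<le> 2"
proof -
  define v where "v = - (2 * pi * \<i> * l * exp u)"
  have nv: "norm v = 2 * pi * l * exp (Re u)" using l_pos by (simp add: v_def norm_mult)
  have "norm (bern v - 1) \<le> 1" using norm_bern_minus_1_le[of v] nv assms l_pos by (auto simp: v_def)
  then show ?thesis using norm_triangle_ineq2[of "bern v" 1] by (simp add: dLt_def v_def)
qed

lemma norm_dLt_circle: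
  assumes "l * exp (Re u) = real n + 1 / 2"
  shows "norm (dLt u) \<le> 4 * pi * l * exp (Re u)"
proof -
  define v where "v = - (2 * pi * \<i> * l * exp u)"
  have nv: "norm v = 2 * pi * l * exp (Re u)" using l_pos by (simp add: v_def norm_mult)
  have "norm (bern v) \<le> 2 * norm v" by (rule norm_bern_le_circle[of v n]) (simp add: nv assms mult.assoc)
  then show ?thesis unfolding dLt_def v_def[symmetric] by (simp add: nv)
qed

text \<open>The kernel decays on the upper line but approaches
  \<open>2 * pi * \<i> * l * exp u\<close> on the lower one. One bound linear in
  \<open>exp (Re u)\<close> covers both, and the decay \<open>exp (- 2 * Re u)\<close> of
  \<open>Ht\<close> beats it.\<close>

lemma norm_dLt_line:
  assumes "\<bar>Im u\<bar> = theta" "c0 * exp (Re u) \<ge> 1"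
  shows "norm (dLt u) \<le> 4 * pi * l * exp (Re u)"
proof -
  define v where "v = - (2 * pi * \<i> * l * exp u)"
  have nv: "norm v = 2 * pi * l * exp (Re u)" using l_pos by (simp add: v_def norm_mult)
  consider "Im u = theta" | "Im u = - theta" using assms by linarith
  then have "norm (bern v) \<le> 2 * norm v"
  proof cases
    case 1
    then have "Re v \<ge> 1" using assms by (simp add: v_def Im_exp c0_def mult_ac)
    then have "norm (bern v) \<le> 2 * norm v * exp (- Re v)" by (rule norm_bern_le_right)
    also have "\<dots> \<le> 2 * norm v * 1" using \<open>Re v \<ge> 1\<close> by (intro mult_left_mono) auto
    finally show ?thesis by simp
  next
    case 2
    then have "Re v \<le> - 1" using assms by (simp add: v_def Im_exp c0_def mult_ac)
    then show ?thesis by (rule norm_bern_le_left)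
  qed
  then show ?thesis unfolding dLt_def v_def[symmetric] by (simp add: nv)
qed

lemma Ht_holo: "Ht holomorphic_on {u. \<bar>Im u\<bar> < 2 * theta}"
  using Ht_deriv by (auto simp: holomorphic_on_def field_differentiable_def intro: has_field_derivative_at_within)

lemma Lt_holo: "Lt holomorphic_on {u. 0 < Im u \<and> Im u < pi}"
  using Lt_deriv by (auto simp: holomorphic_on_def field_differentiable_def intro: has_field_derivative_at_within)

lemma dLt_holo: "dLt holomorphic_on {u. exp (- (2 * pi * \<i> * l * exp u)) \<noteq> 1}"
  unfolding dLt_def bern_def by (auto intro!: holomorphic_intros)

lemma dHt_holo: "dHt holomorphic_on {u. exp (exp (of_nat k * u)) \<noteq> 1 \<and> exp (2 * u) \<noteq> - 1}"
  unfolding dHt_def bern_def by (auto intro!: holomorphic_intros simp: add_eq_0_iff)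

lemma exp_dLt_ne_1:
  assumes "0 < \<bar>Im u\<bar>" "\<bar>Im u\<bar> < pi"
  shows "exp (- (2 * pi * \<i> * l * exp u)) \<noteq> 1"
proof -
  have "sin (Im u) \<noteq> 0" using assms sin_gt_zero[of "Im u"] sin_gt_zero[of "- Im u"] by (cases "Im u > 0") auto
  then have "Re (- (2 * pi * \<i> * l * exp u)) \<noteq> 0" using l_pos by (simp add: Im_exp)
  then show ?thesis by (metis exp_eq_1)
qed

lemma exp_exp_k_ne_1:
  assumes "\<bar>Im u\<bar> < 2 * theta"
  shows "exp (exp (of_nat k * u)) \<noteq> 1"
  using Re_exp_k_pos[OF assms] by (metis exp_eq_1 less_irrefl)

lemma exp_2_ne:
  assumes "\<bar>Im u\<bar> < 2 * theta"
  shows "exp (2 * u) \<noteq> - 1"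
proof
  assume "exp (2 * u) = - 1"
  then have "Re (exp (2 * u)) = - 1" by simp
  moreover have "cos (2 * Im u) \<ge> 0" using assms theta_le by (intro cos_ge_zero) linarith+
  then have "Re (exp (2 * u)) \<ge> 0" by (simp add: Re_exp)
  ultimately show False by linarith
qed

lemma exp_eventually_large:
  assumes "c > 0"
  shows "\<forall>\<^sub>F t in at_top. c * exp (t::real) \<ge> C"
  using assms by real_asymp

lemma exp_eventually_small:
  assumes "c > 0"
  shows "\<forall>\<^sub>F t in at_bot. C * exp (t::real) \<le> c"
  using assms by real_asymp

lemma norm_Ht_dLt_bot:
  assumes "\<bar>Im u\<bar> \<le> theta" "Re u \<le> - 3" "2 * pi * l * exp (Re u) \<le> 1 / 6"
  shows "norm (Ht u * dLt u) \<le> (12 + 2 * k) * exp (Re u)"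
proof -
  have "norm (Ht u * dLt u) \<le> ((6 + k) * exp (2 * Re u)) * 2"
    unfolding norm_mult using assms by (intro mult_mono norm_Ht_bot norm_dLt_bot) auto
  also have "\<dots> \<le> ((6 + k) * exp (Re u)) * 2"
    using assms by (intro mult_right_mono mult_left_mono) auto
  finally show ?thesis by (simp add: algebra_simps)
qed

lemma norm_Ht_dLt_top:
  assumes "\<bar>Im u\<bar> \<le> theta" "Re u \<ge> 1" "norm (dLt u) \<le> 4 * pi * l * exp (Re u)"
  shows "norm (Ht u * dLt u) \<le> ((4 + k) * 4 * pi * l) * exp (- Re u)"
proof -
  have "norm (Ht u * dLt u) \<le> ((4 + k) * exp (- 2 * Re u)) * (4 * pi * l * exp (Re u))"
    unfolding norm_mult using assms by (intro mult_mono norm_Ht_top) auto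
  also have "\<dots> = ((4 + k) * 4 * pi * l) * (exp (- 2 * Re u) * exp (Re u))" by simp
  also have "exp (- 2 * Re u) * exp (Re u) = exp (- Re u)" by (simp flip: exp_add)
  finally show ?thesis .
qed

lemma Ht_dLt_integrable:
  assumes "\<bar>y\<bar> = theta"
  shows "(\<lambda>t. Ht (Complex t y) * dLt (Complex t y)) absolutely_integrable_on UNIV"
proof (rule absolutely_integrable_exp_decay)
  have y: "\<bar>y\<bar> < 2 * theta" "0 < \<bar>y\<bar>" "\<bar>y\<bar> < pi" using assms theta_pos theta_le pi_gt_zero by auto
  show "continuous_on UNIV (\<lambda>t. Ht (Complex t y) * dLt (Complex t y))"
    using y exp_dLt_ne_1[of "Complex t y" for t]
    by (intro continuous_on_mult continuous_on_horizontal[OF Ht_holo] continuous_on_horizontal[OF dLt_holo]) auto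
  show "\<forall>\<^sub>F t in at_top. norm (Ht (Complex t y) * dLt (Complex t y)) \<le> ((4 + k) * 4 * pi * l) * exp (- t)"
    using exp_eventually_large[OF c0_pos, of 1] eventually_ge_at_top[of 1]
  proof eventually_elim
    case (elim t)
    then show ?case using norm_Ht_dLt_top[of "Complex t y"] norm_dLt_line[of "Complex t y"] assms by simp
  qed
  show "\<forall>\<^sub>F t in at_bot. norm (Ht (Complex t y) * dLt (Complex t y)) \<le> (12 + 2 * k) * exp t"
    using exp_eventually_small[of "1/6" "2 * pi * l", simplified] eventually_le_at_bot[of "-3"]
  proof eventually_elim
    case (elim t)
    then show ?case using norm_Ht_dLt_bot[of "Complex t y"] assms by simp
  qed
qed

section \<open>Residues in the sector around the positive axis\<close>

text \<open>The left side says that \<open>l * exp u\<close> is an integer. As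
  \<open>\<bar>Im u\<bar> < pi\<close> keeps \<open>exp u\<close> off the negative axis, only
  positive integers remain.\<close>

lemma Ht_dLt_pole_iff:
  assumes "\<bar>Im u\<bar> < pi"
  shows "exp (- (2 * pi * \<i> * l * exp u)) = 1 \<longleftrightarrow> (\<exists>d::nat. d \<ge> 1 \<and> u = of_real (ln (real d / l)))"
    (is "?L \<longleftrightarrow> ?R")
proof
  assume e: ?L
  then have y: "Im u = 0" using exp_dLt_ne_1[of u] assms by auto
  from e obtain n :: int where "Im (- (2 * pi * \<i> * l * exp u)) = 2 * n * pi"
    unfolding exp_eq_1 by blast
  then have "pi * (l * exp (Re u)) = pi * - real_of_int n" using y by (simp add: Re_exp)
  then have n: "l * exp (Re u) = - real_of_int n" by (metis mult_left_cancel pi_neq_zero)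
  then have npos: "- n \<ge> 1" using l_pos by (smt (verit) exp_gt_zero mult_pos_pos of_int_0_less_iff zless_iff_Suc_zadd of_int_minus)
  define d where "d = nat (- n)"
  have d: "real d = l * exp (Re u)" "d \<ge> 1" using n npos by (auto simp: d_def)
  then have "exp (Re u) = d / l" using l_pos by (simp add: field_simps)
  then have "ln (exp (Re u)) = ln (real d / l)" by simp
  then have "Re u = ln (real d / l)" by simp
  then show ?R using y d by (auto simp: complex_eq_iff)
next
  assume ?R
  then obtain d :: nat where d: "d \<ge> 1" "u = of_real (ln (real d / l))" by blast
  then have "exp u = of_real (d / l)" using l_pos by (simp add: exp_of_real del: of_real_divide)
  then have "- (2 * pi * \<i> * l * exp u) = of_real (2 * (- int d) * pi) * \<i>" using l_pos by simp
  then show ?L unfolding exp_eq_1 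
    by (metis Im_i_times Re_complex_of_real Re_i_times Im_complex_of_real mult.commute minus_zero of_int_mult of_int_numeral)
qed

text \<open>As a multiple of \<open>exp u\<close>, the function \<open>v\<close> is its own
  derivative. At a pole the derivative of \<open>exp v - 1\<close> is therefore \<open>v\<close>,
  which cancels the numerator of \<open>bern v\<close>.\<close>

lemma residue_Ht_dLt:
  assumes d: "d \<ge> (1::nat)"
  shows "residue (\<lambda>u. Ht u * dLt u) (of_real (ln (real d / l))) = Ht (of_real (ln (real d / l)))"
proof -
  define q :: complex where "q = of_real (ln (real d / l))"
  define v where "v = (\<lambda>u. - (2 * pi * \<i> * l * exp u))"
  have e: "exp (v q) = 1" using Ht_dLt_pole_iff[of q] d by (auto simp: q_def v_def)
  have v0: "v q \<noteq> 0" using l_pos by (simp add: v_def)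
  have "residue (\<lambda>u. Ht u * dLt u) q = (Ht q * v q) / v q"
  proof (rule residue_quotient_simple_zero)
    show "(\<lambda>u. Ht u * v u) holomorphic_on {u. - (2 * theta) < Im u \<and> Im u < 2 * theta \<and> Re u < Re q + 1}"
      unfolding v_def by (intro holomorphic_intros holomorphic_on_subset[OF Ht_holo]) auto
    show "(\<lambda>u. exp (v u) - 1) holomorphic_on {u. - (2 * theta) < Im u \<and> Im u < 2 * theta \<and> Re u < Re q + 1}"
      unfolding v_def by (intro holomorphic_intros)
    show "((\<lambda>u. exp (v u) - 1) has_field_derivative v q) (at q)"
      using e unfolding v_def by (auto intro!: derivative_eq_intros)
  qed (use theta_pos convex_open_strip(1) e v0 in \<open>auto simp: q_def dLt_def bern_def v_def\<close>)
  then show ?thesis using v0 by (simp add: q_def)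
qed

lemma sum_Ht_limit:
  "(\<lambda>n. 2 * pi * \<i> * (\<Sum>d=1..n. Ht (of_real (ln (real d / l)))))
     \<longlonglongrightarrow> integral UNIV (\<lambda>t. Ht (Complex t (- theta)) * dLt (Complex t (- theta)))
        - integral UNIV (\<lambda>t. Ht (Complex t theta) * dLt (Complex t theta))"
proof -
  define Q where "Q = (\<lambda>n. (\<lambda>d::nat. complex_of_real (ln (real d / l))) ` {1..n})"
  \<comment> \<open>The cut is at the first pole left out, \<open>d = n + 1\<close>, so exactly the
    poles of \<open>Q n\<close> lie in \<open>S n\<close>.\<close>
  define S where "S = (\<lambda>n::nat. {u. - (2 * theta) < Im u \<and> Im u < 2 * theta \<and> Re u < ln ((n + 1) / l)})"
  define a where "a = (\<lambda>n. - real n)"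
  \<comment> \<open>The right edge passes halfway between the poles \<open>n\<close> and
    \<open>n + 1\<close>, as \<open>norm_dLt_circle\<close> requires.\<close>
  define b where "b = (\<lambda>n. ln ((real n + 1 / 2) / l))"
  have a: "filterlim a at_bot sequentially" unfolding a_def by real_asymp
  have b: "filterlim b at_top sequentially" unfolding b_def using l_pos by real_asymp
  have eb: "l * exp (b n) = real n + 1 / 2" for n using l_pos by (simp add: b_def)
  have lim: "(\<lambda>n. 2 * pi * \<i> * (\<Sum>q\<in>Q n. residue (\<lambda>u. Ht u * dLt u) q))
     \<longlonglongrightarrow> integral UNIV (\<lambda>t. Ht (Complex t (- theta)) * dLt (Complex t (- theta)))
        - integral UNIV (\<lambda>t. Ht (Complex t theta) * dLt (Complex t theta))"
  proof (rule residue_strip_limit[where a = a and b = b and S = S and A = "\<lambda>n. (12 + 2 * k) * exp (a n)"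
          and B = "\<lambda>n. ((4 + k) * 4 * pi * l) * exp (- b n)"])
    show "- theta < theta" using theta_pos by simp
    show "(\<lambda>t. Ht (Complex t (- theta)) * dLt (Complex t (- theta))) absolutely_integrable_on UNIV"
      "(\<lambda>t. Ht (Complex t theta) * dLt (Complex t theta)) absolutely_integrable_on UNIV"
      using theta_pos by (auto intro!: Ht_dLt_integrable)
    show "open (S n)" "convex (S n)" for n unfolding S_def by (rule convex_open_strip)+
    show "finite (Q n)" for n by (simp add: Q_def)
    show "(\<lambda>u. Ht u * dLt u) holomorphic_on S n - Q n" for n
    proof (intro holomorphic_on_mult holomorphic_on_subset[OF Ht_holo] holomorphic_on_subset[OF dLt_holo] subsetI)
      fix u assume u: "u \<in> S n - Q n"
      then show "u \<in> {u. \<bar>Im u\<bar> < 2 * theta}" by (auto simp: S_def)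
      have ln: "Re u < ln ((real n + 1) / l)" using u by (simp add: S_def add.commute)
      have "\<not> (\<exists>d::nat. d \<ge> 1 \<and> u = of_real (ln (real d / l)))"
      proof
        assume "\<exists>d::nat. d \<ge> 1 \<and> u = of_real (ln (real d / l))"
        then obtain d :: nat where d: "d \<ge> 1" "u = complex_of_real (ln (real d / l))" by blast
        then have "ln (real d / l) < ln ((real n + 1) / l)" using ln by simp
        then have "real d / l < (real n + 1) / l" by (rule ln_less_cancel_iff[THEN iffD1, rotated 2]) (use d l_pos in auto)
        then have "d \<le> n" using l_pos by (simp add: divide_less_cancel)
        then show False using u d by (auto simp: Q_def)
      qed
      then show "u \<in> {u. exp (- (2 * pi * \<i> * l * exp u)) \<noteq> 1}"
      proof -
        have "\<bar>Im u\<bar> < pi" using u theta_le pi_gt_zero unfolding S_def abs_less_iff by auto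
        with \<open>\<not> _\<close> show ?thesis using Ht_dLt_pole_iff[of u] by simp
      qed
    qed
    show "\<forall>\<^sub>F n in sequentially. cbox (Complex (a n) (- theta)) (Complex (b n) theta) \<subseteq> S n"
    proof (intro always_eventually allI subsetI)
      fix n u assume u: "u \<in> cbox (Complex (a n) (- theta)) (Complex (b n) theta)"
      have "b n < ln ((n + 1) / l)" using l_pos by (simp add: b_def divide_strict_right_mono)
      then show "u \<in> S n" using u theta_pos by (auto simp: in_cbox_complex_iff S_def add.commute)
    qed
    \<comment> \<open>The leftmost pole, \<open>d = 1\<close>, sits at \<open>ln (1 / l)\<close>,
      which is negative if \<open>l > 1\<close>.\<close>
    have "\<forall>\<^sub>F n in sequentially. a n < ln (1 / l)" unfolding a_def by real_asymp
    then show "\<forall>\<^sub>F n in sequentially. Q n \<subseteq> box (Complex (a n) (- theta)) (Complex (b n) theta)"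
    proof eventually_elim
      case (elim n)
      show ?case
      proof
        fix q assume "q \<in> Q n"
        then obtain d where d: "d \<in> {1..n}" "q = complex_of_real (ln (real d / l))" by (auto simp: Q_def)
        have "ln (1 / l) \<le> ln (real d / l)" "ln (real d / l) < b n"
          using d l_pos by (auto simp: b_def divide_right_mono divide_strict_right_mono)
        then show "q \<in> box (Complex (a n) (- theta)) (Complex (b n) theta)"
          using d elim theta_pos by (simp add: in_box_complex_iff)
      qed
    qed
    have "\<forall>\<^sub>F n in sequentially. 2 * pi * l * exp (a n) \<le> 1 / 6 \<and> a n \<le> - 3"
      using eventually_compose_filterlim[OF eventually_conj[OF exp_eventually_small[of "1/6" "2 * pi * l", OF zero_less_divide_1_iff[THEN iffD2]] eventually_le_at_bot[of "-3"]] a] by simp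
    then show "\<forall>\<^sub>F n in sequentially. \<forall>y\<in>{- theta..theta}. cmod (Ht (Complex (a n) y) * dLt (Complex (a n) y)) \<le> (12 + 2 * k) * exp (a n)"
    proof eventually_elim
      case (elim n)
      then show ?case using norm_Ht_dLt_bot[of "Complex (a n) y" for y] by (auto simp: abs_le_iff)
    qed
    show "(\<lambda>n. (12 + 2 * k) * exp (a n)) \<longlonglongrightarrow> 0" unfolding a_def by real_asymp
    have "\<forall>\<^sub>F n in sequentially. b n \<ge> 1" using b by (simp add: filterlim_at_top)
    then show "\<forall>\<^sub>F n in sequentially. \<forall>y\<in>{- theta..theta}. cmod (Ht (Complex (b n) y) * dLt (Complex (b n) y)) \<le> ((4 + k) * 4 * pi * l) * exp (- b n)"
    proof eventually_elim
      case (elim n)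
      then show ?case using norm_Ht_dLt_top[of "Complex (b n) y" for y] norm_dLt_circle[of "Complex (b n) y" n for y] eb[of n]
        by (auto simp: abs_le_iff)
    qed
    show "(\<lambda>n. ((4 + k) * 4 * pi * l) * exp (- b n)) \<longlonglongrightarrow> 0" 
      by (intro tendsto_mult_right_zero filterlim_compose[OF exp_at_bot] filterlim_compose[OF filterlim_uminus_at_bot_at_top b])
  qed (fact a b)+
  have "(\<Sum>q\<in>Q n. residue (\<lambda>u. Ht u * dLt u) q) = (\<Sum>d=1..n. Ht (of_real (ln (real d / l))))" for n
  proof -
    have "inj_on (\<lambda>d::nat. complex_of_real (ln (real d / l))) {1..n}"
      using l_pos by (auto intro!: inj_onI)
    then show ?thesis
      unfolding Q_def by (subst sum.reindex) (auto intro!: sum.cong simp: residue_Ht_dLt)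
  qed
  then show ?thesis using lim by simp
qed

lemma Ht_exp_bot:
  assumes "\<bar>Im u\<bar> \<le> theta" "Re u \<le> - 3"
  shows "norm (Ht u * exp u) \<le> (6 + k) * exp (Re u)"
proof -
  have "norm (Ht u * exp u) \<le> ((6 + k) * exp (2 * Re u)) * exp (Re u)"
    unfolding norm_mult using norm_Ht_bot[OF assms] by (intro mult_mono) auto
  also have "\<dots> \<le> ((6 + k) * 1) * exp (Re u)"
    using assms by (intro mult_right_mono mult_left_mono) auto
  finally show ?thesis by simp
qed

lemma Ht_exp_top:
  assumes "\<bar>Im u\<bar> \<le> theta" "Re u \<ge> 1"
  shows "norm (Ht u * exp u) \<le> (4 + k) * exp (- Re u)"
proof -
  have "norm (Ht u * exp u) \<le> ((4 + k) * exp (- 2 * Re u)) * exp (Re u)"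
    unfolding norm_mult using norm_Ht_top[OF assms] by (intro mult_mono) auto
  also have "\<dots> = (4 + k) * (exp (- 2 * Re u) * exp (Re u))" by simp
  also have "exp (- 2 * Re u) * exp (Re u) = exp (- Re u)" by (simp flip: exp_add)
  finally show ?thesis .
qed

lemma Ht_exp_integrable:
  assumes "\<bar>y\<bar> \<le> theta"
  shows "(\<lambda>t. Ht (Complex t y) * exp (Complex t y)) absolutely_integrable_on UNIV"
proof (rule absolutely_integrable_exp_decay)
  show "continuous_on UNIV (\<lambda>t. Ht (Complex t y) * exp (Complex t y))"
    using assms theta_pos
    by (intro continuous_on_mult continuous_on_horizontal[OF Ht_holo] continuous_on_horizontal[OF holomorphic_on_exp[of UNIV]]) auto
  show "\<forall>\<^sub>F t in at_top. norm (Ht (Complex t y) * exp (Complex t y)) \<le> (4 + k) * exp (- t)"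
    using eventually_ge_at_top[of 1]
  proof eventually_elim
    case (elim t)
    then show ?case using Ht_exp_top[of "Complex t y"] assms by simp
  qed
  show "\<forall>\<^sub>F t in at_bot. norm (Ht (Complex t y) * exp (Complex t y)) \<le> (6 + k) * exp t"
    using eventually_le_at_bot[of "-3"]
  proof eventually_elim
    case (elim t)
    then show ?case using Ht_exp_bot[of "Complex t y"] assms by simp
  qed
qed

text \<open>Cauchy's theorem with an empty pole set. It moves the extra term of the lower line to
  the real axis, where the integral can be computed.\<close>

lemma Ht_exp_shift:
  "integral UNIV (\<lambda>t. Ht (Complex t (- theta)) * exp (Complex t (- theta)))
     = integral UNIV (\<lambda>t. Ht (Complex t 0) * exp (Complex t 0))"
proof -
  define a b where "a = (\<lambda>n::nat. - real n)" and "b = (\<lambda>n::nat. real n)"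
  have a: "filterlim a at_bot sequentially" unfolding a_def by real_asymp
  have b: "filterlim b at_top sequentially" unfolding b_def by real_asymp
  have "(\<lambda>n. 2 * pi * \<i> * (\<Sum>q\<in>{}. residue (\<lambda>u. Ht u * exp u) q))
     \<longlonglongrightarrow> integral UNIV (\<lambda>t. Ht (Complex t (- theta)) * exp (Complex t (- theta)))
     - integral UNIV (\<lambda>t. Ht (Complex t 0) * exp (Complex t 0))"
  proof (rule residue_strip_limit[where a = a and b = b and A = "\<lambda>n. (6 + k) * exp (a n)"
        and B = "\<lambda>n. (4 + k) * exp (- b n)"
        and S = "\<lambda>n. {u. - (2 * theta) < Im u \<and> Im u < 2 * theta \<and> Re u < real n + 1}"])
    show "(\<lambda>u. Ht u * exp u) holomorphic_on {u. - (2 * theta) < Im u \<and> Im u < 2 * theta \<and> Re u < real n + 1} - {}" for n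
      by (intro holomorphic_intros holomorphic_on_subset[OF Ht_holo]) auto
    show "\<forall>\<^sub>F n in sequentially. cbox (Complex (a n) (- theta)) (Complex (b n) 0) \<subseteq> {u. - (2 * theta) < Im u \<and> Im u < 2 * theta \<and> Re u < real n + 1}"
      using theta_pos by (auto simp: in_cbox_complex_iff b_def intro!: always_eventually)
    have "\<forall>\<^sub>F n in sequentially. a n \<le> - 3" using a by (simp add: filterlim_at_bot)
    then show "\<forall>\<^sub>F n in sequentially. \<forall>y\<in>{- theta..0}. cmod (Ht (Complex (a n) y) * exp (Complex (a n) y)) \<le> (6 + k) * exp (a n)"
    proof eventually_elim
      case (elim n)
      then show ?case using Ht_exp_bot[of "Complex (a n) y" for y] by (auto simp: abs_le_iff)
    qed
    have "\<forall>\<^sub>F n in sequentially. b n \<ge> 1" using b by (simp add: filterlim_at_top)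
    then show "\<forall>\<^sub>F n in sequentially. \<forall>y\<in>{- theta..0}. cmod (Ht (Complex (b n) y) * exp (Complex (b n) y)) \<le> (4 + k) * exp (- b n)"
    proof eventually_elim
      case (elim n)
      then show ?case using Ht_exp_top[of "Complex (b n) y" for y] by (auto simp: abs_le_iff)
    qed
    show "(\<lambda>n. (6 + k) * exp (a n)) \<longlonglongrightarrow> 0" unfolding a_def by real_asymp
    show "(\<lambda>n. (4 + k) * exp (- b n)) \<longlonglongrightarrow> 0" unfolding b_def by real_asymp
  qed (use theta_pos a b convex_open_strip Ht_exp_integrable in auto)
  then show ?thesis by (simp add: LIMSEQ_const_iff)
qed

lemma Ht_cnj:
  assumes "\<bar>Im u\<bar> < 2 * theta"
  shows "Ht (cnj u) = cnj (Ht u)"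
proof -
  have "1 - exp (- exp (of_nat k * u)) \<notin> \<real>\<^sub>\<le>\<^sub>0"
    using Re_exp_k_pos[OF assms] by (intro Re_pos_not_nonpos_Reals Re_one_minus_exp_pos) simp
  moreover have "1 + exp (- 2 * u) \<notin> \<real>\<^sub>\<le>\<^sub>0"
    using Re_one_plus_exp_pos[OF assms] by (rule Re_pos_not_nonpos_Reals)
  ultimately show ?thesis by (simp add: Ht_def cnj_Ln exp_cnj)
qed

text \<open>Conjugation also flips the sign of \<open>\<i>\<close> in the argument of
  \<open>bern\<close>, and \<open>bern_minus\<close> undoes this at the cost of a linear
  term.\<close>

lemma dLt_cnj:
  assumes "exp (- (2 * pi * \<i> * l * exp u)) \<noteq> 1"
  shows "dLt (cnj u) = cnj (dLt u) + 2 * pi * \<i> * l * exp (cnj u)"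
proof -
  define v where "v = - (2 * pi * \<i> * l * exp u)"
  have "dLt (cnj u) = bern (cnj (- v))" by (simp add: dLt_def v_def exp_cnj)
  also have "\<dots> = cnj (bern (- v))" by (rule bern_cnj)
  also have "bern (- v) = bern v + v" using assms by (intro bern_minus) (simp add: v_def)
  finally show ?thesis by (simp add: dLt_def v_def exp_cnj)
qed

definition I1 :: complex where "I1 = integral UNIV (\<lambda>t. Ht (Complex t theta) * dLt (Complex t theta))"
definition I3 :: complex where "I3 = integral UNIV (\<lambda>t. dHt (Complex t theta) * Lt (Complex t theta))"
text \<open>In \<open>z = exp u\<close>, the integral of the regularized summand over the positive
  half-line.\<close>

definition J :: complex where "J = integral UNIV (\<lambda>t. Ht (Complex t 0) * exp (Complex t 0))"

text \<open>Below the real axis the kernel is the conjugate of its values above, plus a term that only sees the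
  integral of the summand.\<close>
lemma integral_Ht_dLt_lower:
  "integral UNIV (\<lambda>t. Ht (Complex t (- theta)) * dLt (Complex t (- theta))) = cnj I1 + 2 * pi * \<i> * l * J"
proof -
  have "Ht (Complex t (- theta)) * dLt (Complex t (- theta))
     = cnj (Ht (Complex t theta) * dLt (Complex t theta)) + 2 * pi * \<i> * l * (Ht (Complex t (- theta)) * exp (Complex t (- theta)))" for t
  proof -
    have c: "Complex t (- theta) = cnj (Complex t theta)" by (simp add: complex_eq_iff)
    have "exp (- (2 * pi * \<i> * l * exp (Complex t theta))) \<noteq> 1"
      using theta_pos theta_le pi_gt_zero by (intro exp_dLt_ne_1) auto
    then show ?thesis unfolding c using theta_pos by (simp add: dLt_cnj Ht_cnj algebra_simps)
  qed
  moreover have "(\<lambda>t. cnj (Ht (Complex t theta) * dLt (Complex t theta))) integrable_on UNIV"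
    using Ht_dLt_integrable[of theta] theta_pos unfolding integrable_on_cnj_iff by (auto simp: absolutely_integrable_on_def)
  moreover have "(\<lambda>t. 2 * pi * \<i> * l * (Ht (Complex t (- theta)) * exp (Complex t (- theta)))) integrable_on UNIV"
    using Ht_exp_integrable[of "- theta"] theta_pos by (intro integrable_on_mult_right) (auto simp: absolutely_integrable_on_def)
  ultimately have "integral UNIV (\<lambda>t. Ht (Complex t (- theta)) * dLt (Complex t (- theta)))
     = integral UNIV (\<lambda>t. cnj (Ht (Complex t theta) * dLt (Complex t theta)))
      + integral UNIV (\<lambda>t. 2 * pi * \<i> * l * (Ht (Complex t (- theta)) * exp (Complex t (- theta))))"
    by (simp only: integral_add)
  also have "integral UNIV (\<lambda>t. cnj (Ht (Complex t theta) * dLt (Complex t theta))) = cnj I1"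
    unfolding I1_def by (rule integral_cnj[symmetric])
  also have "integral UNIV (\<lambda>t. 2 * pi * \<i> * l * (Ht (Complex t (- theta)) * exp (Complex t (- theta)))) = 2 * pi * \<i> * l * J"
    unfolding J_def Ht_exp_shift[symmetric] by (rule integral_mult_right)
  finally show ?thesis .
qed

text \<open>\<open>cnj I1 - I1\<close> is \<open>- 2 * \<i> * Im I1\<close>, so only the imaginary
  part of the ray integral enters.\<close>

lemma sum_Ht_limit_J:
  "(\<lambda>n. \<Sum>d=1..n. Ht (of_real (ln (real d / l)))) \<longlonglongrightarrow> l * J - of_real (Im I1 / pi)"
proof -
  have "(\<lambda>n. (2 * pi * \<i> * (\<Sum>d=1..n. Ht (of_real (ln (real d / l))))) / (2 * pi * \<i>))
    \<longlonglongrightarrow> (cnj I1 + 2 * pi * \<i> * l * J - I1) / (2 * pi * \<i>)"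
    by (intro tendsto_divide tendsto_const sum_Ht_limit[unfolded integral_Ht_dLt_lower I1_def[symmetric]]) auto
  also have "cnj I1 + 2 * pi * \<i> * l * J - I1 = 2 * pi * \<i> * (l * J - of_real (Im I1 / pi))"
    by (auto simp: complex_eq_iff field_simps)
  finally show ?thesis by simp
qed

section \<open>Moving the derivative from the kernel to the summand\<close>

lemma dHt_Lt_bot:
  assumes "2 * pi * l * exp (Re u) \<le> 1 / 6" "Re u \<le> - 3"
  shows "norm (dHt u * Lt u) \<le> (8 * k * (1 + pi + \<bar>ln (pi * l)\<bar>)) * exp (Re u)"
proof -
  have "norm (dHt u * Lt u) \<le> (8 * k * exp (2 * Re u)) * ((1 + pi + \<bar>ln (pi * l)\<bar>) * exp (- Re u))"
    unfolding norm_mult using assms by (intro mult_mono norm_dHt_bot norm_Lt_bot) auto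
  also have "\<dots> = (8 * k * (1 + pi + \<bar>ln (pi * l)\<bar>)) * (exp (2 * Re u) * exp (- Re u))" by simp
  also have "exp (2 * Re u) * exp (- Re u) = exp (Re u)" by (simp flip: exp_add)
  finally show ?thesis .
qed

lemma dHt_Lt_top:
  assumes "c0 * exp (Re u) \<ge> 1" "Im u \<in> {theta..pi - theta}" "norm (dHt u) \<le> k * (1 + 2 * exp (k * Re u))"
  shows "norm (dHt u * Lt u) \<le> k * (1 + 2 * exp (k * Re u)) * (2 * exp (- (c0 * exp (Re u))))"
  unfolding norm_mult using assms by (intro mult_mono norm_Lt_top) auto

text \<open>The doubly exponential decay of \<open>Lt\<close> absorbs any growth of order
  \<open>exp (k * t)\<close>, which is why the crude bounds on \<open>dHt\<close> are
  enough.\<close>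

lemma dHt_Lt_top_eventually:
  "\<forall>\<^sub>F t::real in at_top. k * (1 + 2 * exp (k * t)) * (2 * exp (- (c0 * exp t))) \<le> exp (- t)"
proof -
  have "\<forall>\<^sub>F t::real in at_top. K * (1 + 2 * exp (K * t)) * (2 * exp (- (c0 * exp t))) \<le> exp (- t)" if "K > 0" for K
    using c0_pos that by real_asymp
  then show ?thesis using k2 by simp
qed

lemma dHt_Lt_integrable: "(\<lambda>t. dHt (Complex t theta) * Lt (Complex t theta)) absolutely_integrable_on UNIV"
proof (rule absolutely_integrable_exp_decay)
  show "continuous_on UNIV (\<lambda>t. dHt (Complex t theta) * Lt (Complex t theta))"
    using theta_pos theta_le exp_exp_k_ne_1[of "Complex t theta" for t] exp_2_ne[of "Complex t theta" for t] pi_gt_zero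
    by (intro continuous_on_mult continuous_on_horizontal[OF dHt_holo] continuous_on_horizontal[OF Lt_holo]) auto
  show "\<forall>\<^sub>F t in at_top. norm (dHt (Complex t theta) * Lt (Complex t theta)) \<le> 1 * exp (- t)"
    using dHt_Lt_top_eventually exp_eventually_large[OF c0_pos, of 1] eventually_ge_at_top[of 1]
  proof eventually_elim
    case (elim t)
    then show ?case using dHt_Lt_top[of "Complex t theta"] norm_dHt_top_line[of "Complex t theta"] theta_pos theta_le pi_gt_zero by auto
  qed
  show "\<forall>\<^sub>F t in at_bot. norm (dHt (Complex t theta) * Lt (Complex t theta)) \<le> (8 * k * (1 + pi + \<bar>ln (pi * l)\<bar>)) * exp t"
    using exp_eventually_small[of "1/6" "2 * pi * l", simplified] eventually_le_at_bot[of "-3"]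
  proof eventually_elim
    case (elim t)
    then show ?case using dHt_Lt_bot[of "Complex t theta"] by simp
  qed
qed

text \<open>Integration by parts along the line $\mathrm{Im}\,u = \theta$.\<close>
lemma I1_eq: "I1 = - I3"
proof -
  define a b where "a = (\<lambda>n::nat. - real n)" and "b = (\<lambda>n::nat. real n)"
  have a: "filterlim a at_bot sequentially" unfolding a_def by real_asymp
  have b: "filterlim b at_top sequentially" unfolding b_def by real_asymp
  define P where "P = (\<lambda>t. Ht (Complex t theta) * Lt (Complex t theta))"
  define p where "p = (\<lambda>t. Ht (Complex t theta) * dLt (Complex t theta) + dHt (Complex t theta) * Lt (Complex t theta))"
  have deriv: "(P has_vector_derivative p t) (at t)" for t
  proof -
    have d: "((\<lambda>t. Complex t theta) has_vector_derivative 1) (at t)"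
      unfolding Complex_eq by (auto intro!: derivative_eq_intros)
    have "((\<lambda>u. Ht u * Lt u) has_field_derivative (Ht (Complex t theta) * dLt (Complex t theta) + dHt (Complex t theta) * Lt (Complex t theta))) (at (Complex t theta))"
      using theta_pos theta_le pi_gt_zero
      by (auto intro!: derivative_eq_intros Ht_deriv Lt_deriv)
    from field_vector_diff_chain_at[OF d this] show ?thesis by (simp add: P_def p_def o_def)
  qed
  have int: "(p has_integral (P (b n) - P (a n))) {a n..b n}" for n
    using deriv by (intro fundamental_theorem_of_calculus) (auto simp: a_def b_def intro: has_vector_derivative_at_within)
  have absint: "p absolutely_integrable_on UNIV"
    unfolding p_def using theta_pos by (intro set_integral_add(1) Ht_dLt_integrable dHt_Lt_integrable) auto
  have "(\<lambda>n. integral {a n..b n} p) \<longlonglongrightarrow> integral UNIV p"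
    by (rule integral_interval_tendsto_UNIV[OF absint a b])
  then have lim: "(\<lambda>n. P (b n) - P (a n)) \<longlonglongrightarrow> integral UNIV p" using integral_unique[OF int] by simp
  have Pb: "(\<lambda>n. P (b n)) \<longlonglongrightarrow> 0"
  proof (rule Lim_null_comparison)
    have "\<forall>\<^sub>F n in sequentially. b n \<ge> 1 \<and> c0 * exp (b n) \<ge> 1"
      using eventually_compose_filterlim[OF eventually_conj[OF eventually_ge_at_top[of 1] exp_eventually_large[OF c0_pos, of 1]] b] by simp
    then show "\<forall>\<^sub>F n in sequentially. norm (P (b n)) \<le> ((4 + k) * exp (- 2 * b n)) * 2"
    proof eventually_elim
      case (elim n)
      have "norm (Lt (Complex (b n) theta)) \<le> 2 * exp (- (c0 * exp (b n)))"
        using norm_Lt_top[of "Complex (b n) theta"] elim theta_pos theta_le pi_gt_zero by auto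
      also have "\<dots> \<le> 2" using elim by simp
      finally show ?case unfolding P_def norm_mult using norm_Ht_top[of "Complex (b n) theta"] elim theta_pos
        by (intro mult_mono) auto
    qed
    show "(\<lambda>n. ((4 + k) * exp (- 2 * b n)) * 2) \<longlonglongrightarrow> 0" unfolding b_def by real_asymp
  qed
  \<comment> \<open>At this end \<open>Lt\<close> is unbounded; the zero of order at least two of
    the summand at \<open>z = 0\<close> makes the boundary term vanish.\<close>
  have Pa: "(\<lambda>n. P (a n)) \<longlonglongrightarrow> 0"
  proof (rule Lim_null_comparison)
    define C where "C = 1 + pi + \<bar>ln (pi * l)\<bar>"
    have "\<forall>\<^sub>F n in sequentially. 2 * pi * l * exp (a n) \<le> 1 / 6 \<and> a n \<le> - 3"
      using eventually_compose_filterlim[OF eventually_conj[OF exp_eventually_small[of "1/6" "2 * pi * l", OF zero_less_divide_1_iff[THEN iffD2]] eventually_le_at_bot[of "-3"]] a] by simp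
    then show "\<forall>\<^sub>F n in sequentially. norm (P (a n)) \<le> ((6 + k) * exp (2 * a n)) * (C * exp (- a n))"
    proof eventually_elim
      case (elim n)
      then show ?case unfolding P_def norm_mult C_def
        using norm_Ht_bot[of "Complex (a n) theta"] norm_Lt_bot[of "Complex (a n) theta"] theta_pos
        by (intro mult_mono) auto
    qed
    show "(\<lambda>n. ((6 + k) * exp (2 * a n)) * (C * exp (- a n))) \<longlonglongrightarrow> 0" unfolding a_def by real_asymp
  qed
  have "(\<lambda>n. P (b n) - P (a n)) \<longlonglongrightarrow> 0 - 0" by (intro tendsto_diff Pa Pb)
  then have "integral UNIV p = 0" using lim LIMSEQ_unique by force
  moreover have "integral UNIV p = I1 + I3"
    unfolding p_def I1_def I3_def using Ht_dLt_integrable[of theta] dHt_Lt_integrable theta_pos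
    by (intro integral_add) (auto simp: absolutely_integrable_on_def)
  ultimately show ?thesis by (simp add: eq_neg_iff_add_eq_0)
qed

section \<open>Residues in the upper sector\<close>

text \<open>The logarithms of the roots of \<open>z ^ k = \<plusminus> 2 * pi * \<i> * m\<close> in
  the upper half-plane. The angle is measured from the imaginary axis, so that \<open>j\<close>
  matches the phase in \<open>log_term\<close>.\<close>

definition pole :: "nat \<Rightarrow> int \<Rightarrow> complex" where
  "pole m j = Complex (ln (2 * pi * m) / k) (pi / 2 - pi * j / (2 * k))"

lemma exp_2_pole_iff:
  assumes "0 < Im u" "Im u < pi"
  shows "exp (2 * u) = - 1 \<longleftrightarrow> u = \<i> * (pi / 2)"
proof
  assume "exp (2 * u) = - 1"
  then have "exp (2 * u) = exp (of_real pi * \<i>)" by simp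
  then obtain n :: int where n: "2 * u = of_real pi * \<i> + (of_int (2 * n) * pi) * \<i>"
    unfolding exp_eq by blast
  have im: "2 * Im u = pi * (1 + 2 * n)" and re: "Re u = 0"
    using arg_cong[OF n, of Im] arg_cong[OF n, of Re] by (auto simp: algebra_simps)
  have "0 < pi * (1 + 2 * n)" "pi * (1 + 2 * n) < pi * 2" using im assms by linarith+
  then have "n = 0" by (simp add: zero_less_mult_iff)
  then show "u = \<i> * (pi / 2)" using im re by (simp add: complex_eq_iff)
next
  assume "u = \<i> * (pi / 2)"
  then have "2 * u = of_real pi * \<i>" by (simp add: complex_eq_iff)
  then show "exp (2 * u) = - 1" by simp
qed

text \<open>The extreme indices \<open>\<plusminus> (k - 1)\<close> lie at angle
  \<open>pi / (2 * k) = 2 * theta\<close> from the real axis, hence strictly inside the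
  contour.\<close>

lemma pole_bounds:
  assumes "j \<in> index_set k"
  shows "Im (pole m j) \<in> {2 * theta..pi - 2 * theta}"
proof -
  have "\<bar>real_of_int j\<bar> \<le> k - 1" using index_set_bounds[OF assms] k2 by linarith
  then have "pi * \<bar>real_of_int j\<bar> / (2 * k) \<le> pi * (k - 1) / (2 * k)"
    using k2 by (intro divide_right_mono mult_left_mono) auto
  also have "\<dots> = pi / 2 - 2 * theta" using k2 by (simp add: theta_def field_simps)
  finally have "\<bar>pi * real_of_int j / (2 * k)\<bar> \<le> pi / 2 - 2 * theta" by (simp add: abs_mult)
  then have "pi * real_of_int j / (2 * k) \<le> pi / 2 - 2 * theta" "- (pi * real_of_int j / (2 * k)) \<le> pi / 2 - 2 * theta"
    by linarith+
  then show ?thesis by (simp add: pole_def)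
qed

text \<open>\<open>k * Im (pole m j)\<close> is an odd multiple of \<open>pi / 2\<close>. The sign
  \<open>s\<close> depends on \<open>j\<close>, but either sign makes the outer exponential equal to
  1.\<close>

lemma exp_k_pole:
  assumes "m \<ge> 1" "j \<in> index_set k"
  obtains s :: int where "\<bar>s\<bar> = 1" "exp (of_nat k * pole m j) = of_real (2 * pi * m * s) * \<i>"
proof -
  have im: "k * Im (pole m j) = (int k - j) * (pi / 2)" and re: "k * Re (pole m j) = ln (2 * pi * m)"
    using k2 by (auto simp: pole_def field_simps)
  have "even (int k)" "j mod 2 = (int k - 1) mod 2" using assms(2) k_even by (auto simp: index_set_def)
  then have "odd (int k - j)" by presburger
  then have c: "cos (k * Im (pole m j)) = 0" unfolding cos_zero_iff_int im by blast
  then have "(sin (k * Im (pole m j)))\<^sup>2 = 1\<^sup>2" using sin_cos_squared_add[of "k * Im (pole m j)"] by simp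
  then have "sin (k * Im (pole m j)) = 1 \<or> sin (k * Im (pole m j)) = - 1" unfolding power2_eq_iff by simp
  then obtain s :: int where s: "\<bar>s\<bar> = 1" "sin (k * Im (pole m j)) = s"
    by (metis abs_1 abs_minus of_int_1 of_int_minus)
  have "exp (ln (2 * pi * m)) = 2 * pi * m" using assms by simp
  then have "exp (of_nat k * pole m j) = of_real (2 * pi * m * s) * \<i>"
    using c s re by (simp add: complex_eq_iff Re_exp Im_exp)
  with s show ?thesis using that by blast
qed

text \<open>If \<open>exp w = 1\<close> with \<open>w = exp (of_nat k * u)\<close>, then
  \<open>w\<close> is \<open>2 * pi * \<i> * n\<close> with \<open>n\<close> nonzero. Its modulus
  gives \<open>m = \<bar>n\<bar>\<close>; its angle gives an odd multiple \<open>i\<close> of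
  \<open>pi / (2 * k)\<close> with \<open>0 < i < 2 * k\<close>.\<close>

lemma exp_exp_k_pole_iff:
  assumes "0 < Im u" "Im u < pi"
  shows "exp (exp (of_nat k * u)) = 1 \<longleftrightarrow> (\<exists>m\<ge>1. \<exists>j\<in>index_set k. u = pole m j)"
proof
  assume "exp (exp (of_nat k * u)) = 1"
  then obtain n :: int where re: "Re (exp (of_nat k * u)) = 0" and im: "Im (exp (of_nat k * u)) = 2 * n * pi"
    unfolding exp_eq_1 by auto
  have c: "cos (k * Im u) = 0" using re by (simp add: Re_exp)
  then obtain i :: int where i: "odd i" "k * Im u = i * (pi / 2)" unfolding cos_zero_iff_int by blast
  have "\<bar>sin (k * Im u)\<bar> = 1" using c sin_cos_squared_add[of "k * Im u"] by (auto simp: power2_eq_1_iff)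
  moreover have "\<bar>exp (k * Re u) * sin (k * Im u)\<bar> = \<bar>2 * n * pi\<bar>" using im by (simp add: Im_exp)
  ultimately have e: "exp (k * Re u) = 2 * pi * real_of_int \<bar>n\<bar>" by (simp add: abs_mult)
  define m where "m = nat \<bar>n\<bar>"
  have m: "exp (k * Re u) = 2 * pi * real m" using e by (simp add: m_def)
  then have m1: "m \<ge> 1" using exp_gt_zero[of "k * Re u"] by (cases m) auto
  have "ln (exp (k * Re u)) = ln (2 * pi * m)" using m by simp
  then have "Re u = ln (2 * pi * m) / k" using k2 by (simp add: field_simps)
  \<comment> \<open>This recentres the angle from the real axis to the imaginary axis.\<close>
  moreover define j where "j = int k - i"
  have "Im u = pi / 2 - pi * j / (2 * k)"
    using i k2 by (simp add: j_def field_simps)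
  moreover have "j \<in> index_set k"
  proof -
    have "0 < i * (pi / 2)" "i * (pi / 2) < k * pi"
      unfolding i(2)[symmetric] using assms k2 by auto
    then have "0 < real_of_int i" "real_of_int i < 2 * k" by (auto simp: zero_less_mult_iff)
    then have "0 < i" "i < 2 * int k" by linarith+
    moreover have "j mod 2 = (int k - 1) mod 2" using i(1) unfolding j_def by presburger
    ultimately show ?thesis by (auto simp: index_set_def j_def)
  qed
  ultimately have "u = pole m j" by (simp add: pole_def complex_eq_iff)
  then show "\<exists>m\<ge>1. \<exists>j\<in>index_set k. u = pole m j" using m1 \<open>j \<in> index_set k\<close> by blast
next
  assume "\<exists>m\<ge>1. \<exists>j\<in>index_set k. u = pole m j"
  then obtain m j where m: "m \<ge> 1" "j \<in> index_set k" "u = pole m j" by blast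
  obtain s :: int where s: "exp (of_nat k * u) = of_real (2 * pi * m * s) * \<i>"
    using exp_k_pole[OF m(1,2)] m(3) by metis
  have "Re (exp (of_nat k * u)) = 0" "Im (exp (of_nat k * u)) = of_int (2 * (m * s)) * pi"
    unfolding s by auto
  then show "exp (exp (of_nat k * u)) = 1" unfolding exp_eq_1 by blast
qed

lemma pole_inj: "inj_on (\<lambda>(m, j). pole m j) ({1..n} \<times> index_set k)"
  using k2 by (auto simp: inj_on_def pole_def)

text \<open>The roots have modulus \<open>(2 * pi * m) powr (1 / k) > 1\<close>, so none collides
  with \<open>z = \<i>\<close> and all poles stay simple.\<close>

lemma pole_ne: "m \<ge> 1 \<Longrightarrow> pole m j \<noteq> \<i> * (pi / 2)"
proof
  assume m: "m \<ge> 1" and "pole m j = \<i> * (pi / 2)"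
  then have "ln (2 * pi * m) = 0" using k2 by (simp add: pole_def complex_eq_iff)
  moreover have "2 * pi * m > 1"
  proof -
    have "2 * 3 * 1 \<le> 2 * pi * real m" using m pi_gt3 by (intro mult_mono) auto
    then show ?thesis by linarith
  qed
  ultimately show False using m by (simp add: ln_eq_zero_iff)
qed

text \<open>The two fractions of \<^term>\<open>dHt\<close> are put over a common denominator, so that both kinds of simple
  poles are covered.\<close>
lemma residue_dHt_Lt:
  fixes u :: complex
  assumes u: "0 < Im u" "Im u < pi"
    and h': "h' = 2 * exp (2 * u) * (exp (exp (of_nat k * u)) - 1)
       + (1 + exp (2 * u)) * (exp (exp (of_nat k * u)) * (exp (of_nat k * u) * of_nat k))"
    and zero: "(1 + exp (2 * u)) * (exp (exp (of_nat k * u)) - 1) = 0" and nz: "h' \<noteq> 0"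
  shows "residue (\<lambda>u. dHt u * Lt u) u
     = of_nat k * Lt u * (exp (exp (of_nat k * u)) - 1 - exp (of_nat k * u) * (1 + exp (2 * u))) / h'"
proof (rule residue_quotient_simple_zero)
  define S where "S = {z. 0 < Im z \<and> Im z < pi \<and> Re z < Re u + 1}"
  show "open S" unfolding S_def by (rule convex_open_strip)
  show "u \<in> S" using u by (simp add: S_def)
  show "(\<lambda>u. of_nat k * Lt u * (exp (exp (of_nat k * u)) - 1 - exp (of_nat k * u) * (1 + exp (2 * u)))) holomorphic_on S"
    by (intro holomorphic_intros holomorphic_on_subset[OF Lt_holo]) (auto simp: S_def)
  show "(\<lambda>u. (1 + exp (2 * u)) * (exp (exp (of_nat k * u)) - 1)) holomorphic_on S"
    by (intro holomorphic_intros)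
  show "((\<lambda>u. (1 + exp (2 * u)) * (exp (exp (of_nat k * u)) - 1)) has_field_derivative h') (at u)"
    unfolding h' by (auto intro!: derivative_eq_intros)
  show "(1 + exp (2 * u)) * (exp (exp (of_nat k * u)) - 1) = 0" "h' \<noteq> 0" by fact+
  show "dHt w * Lt w = of_nat k * Lt w * (exp (exp (of_nat k * w)) - 1 - exp (of_nat k * w) * (1 + exp (2 * w)))
      / ((1 + exp (2 * w)) * (exp (exp (of_nat k * w)) - 1))"
    if "(1 + exp (2 * w)) * (exp (exp (of_nat k * w)) - 1) \<noteq> 0" for w
  proof -
    define A W B where "A = 1 + exp (2 * w)" and "W = exp (of_nat k * w)" and "B = exp W - 1"
    have "A \<noteq> 0" "B \<noteq> 0" using that by (auto simp: A_def B_def W_def)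
    then have "of_nat k * (1 / A - W / B) * Lt w = of_nat k * Lt w * (B - W * A) / (A * B)"
      by (simp add: field_simps)
    then show ?thesis by (simp add: A_def B_def W_def dHt_def bern_def)
  qed
qed

text \<open>\<open>dHt\<close> contains minus the logarithmic derivative of
  \<open>1 - exp (- exp (of_nat k * u))\<close>, which has a simple zero here.\<close>

lemma residue_dHt_Lt_pole:
  assumes "m \<ge> 1" "j \<in> index_set k"
  shows "residue (\<lambda>u. dHt u * Lt u) (pole m j) = - Lt (pole m j)"
proof -
  define u where "u = pole m j"
  have u: "0 < Im u" "Im u < pi" using pole_bounds[OF assms(2), of m] theta_pos by (auto simp: u_def)
  have e: "exp (exp (of_nat k * u)) = 1" using exp_exp_k_pole_iff[OF u] assms by (auto simp: u_def)
  have "exp (2 * u) \<noteq> - 1" using exp_2_pole_iff[OF u] pole_ne[OF assms(1)] by (auto simp: u_def)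
  then have n: "1 + exp (2 * u) \<noteq> 0" by (simp add: add_eq_0_iff)
  have "residue (\<lambda>u. dHt u * Lt u) u = of_nat k * Lt u * (- (exp (of_nat k * u) * (1 + exp (2 * u))))
       / ((1 + exp (2 * u)) * (exp (of_nat k * u) * of_nat k))"
    using n k2 by (subst residue_dHt_Lt[OF u refl]) (auto simp: e)
  also have "\<dots> = - Lt u" using n k2 by simp
  finally show ?thesis by (simp add: u_def)
qed

text \<open>Here the pole comes from \<open>- k / 2\<close> times the logarithmic derivative of
  \<open>1 + exp (- 2 * u)\<close>.\<close>

lemma residue_dHt_Lt_i: "residue (\<lambda>u. dHt u * Lt u) (\<i> * (pi / 2)) = - (of_nat k / 2) * Lt (\<i> * (pi / 2))"
proof -
  define u where "u = \<i> * (pi / 2)"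
  have u: "0 < Im u" "Im u < pi" by (auto simp: u_def)
  have e: "exp (2 * u) = - 1" using exp_2_pole_iff[OF u] by (simp add: u_def)
  have n: "exp (exp (of_nat k * u)) \<noteq> 1" using exp_exp_k_pole_iff[OF u] pole_ne by (auto simp: u_def)
  define B where "B = exp (exp (of_nat k * u)) - 1"
  have B: "B \<noteq> 0" using n by (simp add: B_def)
  have "residue (\<lambda>u. dHt u * Lt u) u = of_nat k * Lt u * B / (- 2 * B)"
    using n unfolding B_def by (subst residue_dHt_Lt[OF u refl]) (auto simp: e)
  also have "\<dots> = - (of_nat k / 2) * Lt u" using B by (simp add: field_simps)
  finally show ?thesis by (simp add: u_def)
qed

text \<open>The reflection $z \mapsto -\overline{z}$; this is where $k$ has to be even.\<close>
lemma dHt_Lt_reflect: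
  assumes "0 < y" "y < pi"
  shows "dHt (Complex t (pi - y)) * Lt (Complex t (pi - y)) = cnj (dHt (Complex t y) * Lt (Complex t y))"
proof -
  define u where "u = Complex t y"
  have e: "Complex t (pi - y) = of_real pi * \<i> + cnj u" by (simp add: u_def complex_eq_iff)
  have e1: "exp (Complex t (pi - y)) = - cnj (exp u)" by (simp add: e exp_add exp_cnj)
  have ek: "exp (of_nat m * Complex t (pi - y)) = cnj (exp (of_nat m * u))" if "even m" for m
    unfolding exp_of_nat_mult e1 using that by (simp flip: complex_cnj_power)
  have e2: "exp (2 * Complex t (pi - y)) = cnj (exp (2 * u))" using ek[of 2] by simp
  have "dHt (Complex t (pi - y)) = cnj (dHt u)"
    unfolding dHt_def ek[OF k_even] e2 bern_cnj by simp
  moreover have "Lt (Complex t (pi - y)) = cnj (Lt u)"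
  proof -
    have "1 - exp (2 * pi * \<i> * l * exp u) \<notin> \<real>\<^sub>\<le>\<^sub>0"
      using assms l_pos by (intro Re_pos_not_nonpos_Reals Re_one_minus_exp_pos) (auto simp: u_def Im_exp sin_gt_zero)
    then show ?thesis unfolding Lt_def e1 by (simp add: cnj_Ln exp_cnj)
  qed
  ultimately show ?thesis by (simp add: u_def)
qed

lemma sum_Lt_limit:
  "(\<lambda>n. \<Sum>m=1..n. \<Sum>j\<in>index_set k. Lt (pole m j))
     \<longlonglongrightarrow> - (of_nat k / 2) * Lt (\<i> * (pi / 2)) - of_real (Im I3 / pi)"
proof -
  define i2 where "i2 = \<i> * (pi / 2)"
  define Q0 where "Q0 = (\<lambda>n. (\<lambda>(m, j). pole m j) ` ({1..n} \<times> index_set k))"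
  define Q where "Q = (\<lambda>n. insert i2 (Q0 n))"
  define S where "S = (\<lambda>n::nat. {u. 0 < Im u \<and> Im u < pi \<and> Re u < ln (2 * pi * (real n + 1)) / k})"
  define a where "a = (\<lambda>n. - real n)"
  \<comment> \<open>The right edge has \<open>\<bar>z ^ k\<bar> = 2 * pi * (n + 1 / 2)\<close>,
    halfway between consecutive circles of poles.\<close>
  define b where "b = (\<lambda>n. ln (2 * pi * (real n + 1 / 2)) / k)"
  have a: "filterlim a at_bot sequentially" unfolding a_def by real_asymp
  have kpos: "real k > 0" using k2 by simp
  have b: "filterlim b at_top sequentially" unfolding b_def using kpos by real_asymp
  have eb: "exp (k * b n) = 2 * pi * (real n + 1 / 2)" for n using k2 by (simp add: b_def)
  have upper: "integral UNIV (\<lambda>t. dHt (Complex t (pi - theta)) * Lt (Complex t (pi - theta))) = cnj I3"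
    unfolding I3_def integral_cnj using dHt_Lt_reflect[of theta] theta_pos theta_le pi_gt_zero by simp
  have lim: "(\<lambda>n. 2 * pi * \<i> * (\<Sum>q\<in>Q n. residue (\<lambda>u. dHt u * Lt u) q))
     \<longlonglongrightarrow> I3 - cnj I3"
    unfolding upper[symmetric] unfolding I3_def
  proof (rule residue_strip_limit[where a = a and b = b and S = S and A = "\<lambda>n. (8 * k * (1 + pi + \<bar>ln (pi * l)\<bar>)) * exp (a n)"
          and B = "\<lambda>n. k * (1 + 2 * exp (k * b n)) * (2 * exp (- (c0 * exp (b n))))"])
    show "theta < pi - theta" using theta_le pi_gt_zero by linarith
    show "(\<lambda>t. dHt (Complex t theta) * Lt (Complex t theta)) absolutely_integrable_on UNIV" by (rule dHt_Lt_integrable)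
    then show "(\<lambda>t. dHt (Complex t (pi - theta)) * Lt (Complex t (pi - theta))) absolutely_integrable_on UNIV"
      using dHt_Lt_reflect[of theta] theta_pos theta_le pi_gt_zero
      by (simp add: absolutely_integrable_on_def integrable_on_cnj_iff del: complex_cnj_mult)
    show "open (S n)" "convex (S n)" for n unfolding S_def by (rule convex_open_strip)+
    show "finite (Q n)" for n by (simp add: Q_def Q0_def)
    show "(\<lambda>u. dHt u * Lt u) holomorphic_on S n - Q n" for n
    proof (intro holomorphic_on_mult holomorphic_on_subset[OF dHt_holo] holomorphic_on_subset[OF Lt_holo] subsetI)
      fix u assume u: "u \<in> S n - Q n"
      then show "u \<in> {u. 0 < Im u \<and> Im u < pi}" by (auto simp: S_def)
      have im: "0 < Im u" "Im u < pi" and re: "Re u < ln (2 * pi * (real n + 1)) / k" using u by (auto simp: S_def)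
      have "exp (2 * u) \<noteq> - 1" using exp_2_pole_iff[OF im] u by (auto simp: Q_def i2_def)
      moreover have "exp (exp (of_nat k * u)) \<noteq> 1"
      proof
        assume "exp (exp (of_nat k * u)) = 1"
        then obtain m j where m: "m \<ge> 1" "j \<in> index_set k" "u = pole m j" using exp_exp_k_pole_iff[OF im] by auto
        then have "ln (2 * pi * m) / k < ln (2 * pi * (real n + 1)) / k" using re by (simp add: pole_def)
        then have "ln (2 * pi * m) < ln (2 * pi * (real n + 1))" using kpos by (simp only: divide_less_cancel)
        then have "2 * pi * m < 2 * pi * (real n + 1)"
          by (rule ln_less_cancel_iff[THEN iffD1, rotated 2]) (use m in auto)
        then have "m \<le> n" by simp
        then show False using m u by (auto simp: Q_def Q0_def)
      qed
      ultimately show "u \<in> {u. exp (exp (of_nat k * u)) \<noteq> 1 \<and> exp (2 * u) \<noteq> - 1}" by simp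
    qed
    show "\<forall>\<^sub>F n in sequentially. cbox (Complex (a n) theta) (Complex (b n) (pi - theta)) \<subseteq> S n"
    proof (intro always_eventually allI subsetI)
      fix n u assume u: "u \<in> cbox (Complex (a n) theta) (Complex (b n) (pi - theta))"
      have "ln (2 * pi * (real n + 1 / 2)) < ln (2 * pi * (real n + 1))"
        by (intro ln_less_cancel_iff[THEN iffD2] mult_strict_left_mono) auto
      then have "b n < ln (2 * pi * (real n + 1)) / k"
        unfolding b_def using kpos by (intro divide_strict_right_mono)
      then show "u \<in> S n" using u theta_pos by (auto simp: in_cbox_complex_iff S_def)
    qed
    \<comment> \<open>All poles have \<open>Re u \<ge> 0\<close>, so a negative left edge encloses
      them.\<close>
    have "\<forall>\<^sub>F n in sequentially. a n < 0" unfolding a_def by real_asymp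
    then show "\<forall>\<^sub>F n in sequentially. Q n \<subseteq> box (Complex (a n) theta) (Complex (b n) (pi - theta))"
    proof eventually_elim
      case (elim n)
      have ge0: "0 \<le> ln (2 * pi * m) / k" if "m \<ge> 1/2" for m
      proof -
        have "1 \<le> 2 * 3 * (1/2::real)" by simp
        also have "\<dots> \<le> 2 * pi * m" using that pi_gt3 by (intro mult_mono) auto
        finally show ?thesis using kpos by simp
      qed
      have b0: "0 < b n"
      proof -
        have "1 < 2 * 3 * (1/2::real)" by simp
        also have "\<dots> \<le> 2 * pi * (real n + 1/2)" using pi_gt3 by (intro mult_mono) auto
        finally show ?thesis using kpos by (simp add: b_def)
      qed
      show ?case
      proof
        fix q assume "q \<in> Q n"
        then consider "q = i2" | m j where "m \<in> {1..n}" "j \<in> index_set k" "q = pole m j" by (auto simp: Q_def Q0_def)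
        then show "q \<in> box (Complex (a n) theta) (Complex (b n) (pi - theta))"
        proof cases
          case 1
          have "Re q = 0" "Im q = pi / 2" by (simp_all add: 1 i2_def)
          moreover have "theta < pi / 2" using theta_le pi_gt_zero by linarith
          ultimately show ?thesis using elim b0 by (simp add: in_box_complex_iff)
        next
          case 2
          have "ln (2 * pi * m) < ln (2 * pi * (real n + 1 / 2))"
            using 2 by (intro ln_less_cancel_iff[THEN iffD2] mult_strict_left_mono) auto
          then have "Re q < b n" unfolding b_def 2 pole_def using kpos by (auto intro: divide_strict_right_mono)
          moreover have "0 \<le> Re q" using ge0[of m] 2 by (simp add: pole_def)
          ultimately show ?thesis using 2 elim theta_pos pole_bounds[of j m] by (auto simp: in_box_complex_iff)
        qed
      qed
    qed
    have "\<forall>\<^sub>F n in sequentially. 2 * pi * l * exp (a n) \<le> 1 / 6 \<and> a n \<le> - 3"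
      using eventually_compose_filterlim[OF eventually_conj[OF exp_eventually_small[of "1/6" "2 * pi * l", OF zero_less_divide_1_iff[THEN iffD2]] eventually_le_at_bot[of "-3"]] a] by simp
    then show "\<forall>\<^sub>F n in sequentially. \<forall>y\<in>{theta..pi - theta}. cmod (dHt (Complex (a n) y) * Lt (Complex (a n) y)) \<le> (8 * k * (1 + pi + \<bar>ln (pi * l)\<bar>)) * exp (a n)"
    proof eventually_elim
      case (elim n)
      then show ?case using dHt_Lt_bot[of "Complex (a n) y" for y] by auto
    qed
    show "(\<lambda>n. (8 * k * (1 + pi + \<bar>ln (pi * l)\<bar>)) * exp (a n)) \<longlonglongrightarrow> 0" unfolding a_def by real_asymp
    have "\<forall>\<^sub>F n in sequentially. b n \<ge> 1 \<and> c0 * exp (b n) \<ge> 1"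
      using eventually_compose_filterlim[OF eventually_conj[OF eventually_ge_at_top[of 1] exp_eventually_large[OF c0_pos, of 1]] b] by simp
    then show "\<forall>\<^sub>F n in sequentially. \<forall>y\<in>{theta..pi - theta}. cmod (dHt (Complex (b n) y) * Lt (Complex (b n) y)) \<le> k * (1 + 2 * exp (k * b n)) * (2 * exp (- (c0 * exp (b n))))"
    proof eventually_elim
      case (elim n)
      then show ?case using dHt_Lt_top[of "Complex (b n) y" for y] norm_dHt_top_circle[of "Complex (b n) y" n for y] eb[of n] by auto
    qed
    show "(\<lambda>n. k * (1 + 2 * exp (k * b n)) * (2 * exp (- (c0 * exp (b n))))) \<longlonglongrightarrow> 0"
    proof (rule Lim_null_comparison)
      show "\<forall>\<^sub>F n in sequentially. norm (k * (1 + 2 * exp (k * b n)) * (2 * exp (- (c0 * exp (b n))))) \<le> exp (- b n)"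
        using eventually_compose_filterlim[OF dHt_Lt_top_eventually b] by simp
      show "(\<lambda>n. exp (- b n)) \<longlonglongrightarrow> 0"
        by (intro filterlim_compose[OF exp_at_bot] filterlim_compose[OF filterlim_uminus_at_bot_at_top b])
    qed
  qed (fact a b)+
  have sum: "(\<Sum>q\<in>Q n. residue (\<lambda>u. dHt u * Lt u) q)
     = - (of_nat k / 2) * Lt i2 - (\<Sum>m=1..n. \<Sum>j\<in>index_set k. Lt (pole m j))" for n
  proof -
    have "i2 \<notin> Q0 n" using pole_ne[folded i2_def] unfolding Q0_def by fastforce
    then have "(\<Sum>q\<in>Q n. residue (\<lambda>u. dHt u * Lt u) q)
       = residue (\<lambda>u. dHt u * Lt u) i2 + (\<Sum>q\<in>Q0 n. residue (\<lambda>u. dHt u * Lt u) q)"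
      unfolding Q_def by (subst sum.insert) (auto simp: Q0_def)
    also have "(\<Sum>q\<in>Q0 n. residue (\<lambda>u. dHt u * Lt u) q) = (\<Sum>(m, j)\<in>{1..n} \<times> index_set k. - Lt (pole m j))"
      unfolding Q0_def by (subst sum.reindex[OF pole_inj]) (auto intro!: sum.cong simp: residue_dHt_Lt_pole)
    also have "\<dots> = - (\<Sum>m=1..n. \<Sum>j\<in>index_set k. Lt (pole m j))"
      by (simp add: sum.cartesian_product[symmetric] sum_negf)
    finally show ?thesis using residue_dHt_Lt_i[folded i2_def] by simp
  qed
  have "(\<lambda>n. - (of_nat k / 2) * Lt i2 - (2 * pi * \<i> * (\<Sum>q\<in>Q n. residue (\<lambda>u. dHt u * Lt u) q)) / (2 * pi * \<i>))
     \<longlonglongrightarrow> - (of_nat k / 2) * Lt i2 - (I3 - cnj I3) / (2 * pi * \<i>)"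
    by (intro tendsto_intros lim) auto
  also have "(I3 - cnj I3) / (2 * pi * \<i>) = of_real (Im I3 / pi)"
    by (simp add: complex_eq_iff Re_divide Im_divide field_simps)
  finally show ?thesis by (simp add: sum i2_def)
qed

section \<open>The real integral and the theorem\<close>

text \<open>On the real axis the two logarithms of \<open>Ht\<close> are real and can be integrated
  separately.\<close>

lemma J_eq: "J = of_real (Gamma (1 / k) / k * Re (zeta (of_real (1 + 1 / real k))) - k * pi / 2)"
proof -
  define F where "F = (\<lambda>t::real. - ln (1 - exp (- exp (k * t))) * exp t - k / 2 * (ln (1 + exp (- 2 * t)) * exp t))"
  have "(F has_integral (Gamma (1 / k) / k * Re (zeta (of_real (1 + 1 / real k))) - k / 2 * pi)) UNIV"
    unfolding F_def using k2
    by (intro has_integral_diff has_integral_mult_right has_integral_ln_one_plus has_integral_ln_one_minus_exp_exp) auto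
  then have "((\<lambda>t. complex_of_real (F t)) has_integral of_real (Gamma (1 / k) / k * Re (zeta (of_real (1 + 1 / real k))) - k / 2 * pi)) UNIV"
    by (rule has_integral_of_real)
  moreover have "complex_of_real (F t) = Ht (Complex t 0) * exp (Complex t 0)" for t
  proof -
    have c: "Complex t 0 = of_real t" by (simp add: complex_eq_iff)
    have "Ln (1 - exp (- exp (of_nat k * of_real t))) = of_real (ln (1 - exp (- exp (k * t))))"
      by (subst Ln_of_real[symmetric]) (auto simp: exp_of_real[symmetric])
    moreover have "Ln (1 + exp (- 2 * of_real t)) = of_real (ln (1 + exp (- 2 * t)))"
      by (subst Ln_of_real[symmetric]) (auto simp: exp_of_real[symmetric] add_pos_pos)
    ultimately show ?thesis unfolding c Ht_def F_def by (simp add: exp_of_real algebra_simps)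
  qed
  ultimately show ?thesis unfolding J_def by (simp add: integral_unique)
qed

lemma Ht_real:
  assumes d: "d \<ge> (1::nat)"
  shows "Ht (of_real (ln (real d / l))) = of_real (- ln (1 - exp (- ((real d / l) ^ k))) - k / 2 * ln (1 + (l / real d)\<^sup>2))"
proof -
  define s where "s = real d / l"
  have s: "s > 0" using d l_pos by (simp add: s_def)
  have e1: "exp (of_nat k * complex_of_real (ln s)) = of_real (s ^ k)"
    using s by (simp add: exp_of_nat_mult exp_of_real)
  have "exp (- 2 * complex_of_real (ln s)) = of_real (exp (- 2 * ln s))" by (simp flip: exp_of_real)
  also have "exp (- 2 * ln s) = inverse (exp (ln s) ^ 2)" by (simp add: exp_minus flip: exp_of_nat_mult)
  finally have e2: "exp (- 2 * complex_of_real (ln s)) = of_real ((l / real d)\<^sup>2)"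
    using s by (simp add: s_def power_divide)
  have "1 - exp (- (of_real (s ^ k))) = complex_of_real (1 - exp (- (s ^ k)))" by (simp flip: exp_of_real)
  moreover have "Ln (of_real (1 - exp (- (s ^ k)))) = of_real (ln (1 - exp (- (s ^ k))))"
    using s by (intro Ln_of_real) simp
  moreover have "1 + of_real ((l / real d)\<^sup>2) = complex_of_real (1 + (l / real d)\<^sup>2)" by simp
  moreover have "Ln (of_real (1 + (l / real d)\<^sup>2)) = of_real (ln (1 + (l / real d)\<^sup>2))"
    by (intro Ln_of_real add_pos_nonneg) auto
  ultimately show ?thesis unfolding Ht_def s_def[symmetric] e1 e2 by (simp only:) simp
qed

lemma Lt_i: "Lt (\<i> * (pi / 2)) = of_real (ln (1 - exp (- 2 * pi * l)))"
proof -
  have "exp (\<i> * (pi / 2)) = \<i>" by (simp add: complex_eq_iff Re_exp Im_exp) 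
  then have "Lt (\<i> * (pi / 2)) = Ln (1 - exp (of_real (- 2 * pi * l)))"
    unfolding Lt_def by (intro arg_cong[of _ _ "\<lambda>z. Ln (1 - exp z)"]) (simp add: mult_ac)
  also have "1 - exp (of_real (- 2 * pi * l)) = complex_of_real (1 - exp (- 2 * pi * l))"
    by (simp only: exp_of_real of_real_diff of_real_1)
  also have "Ln \<dots> = of_real (ln (1 - exp (- 2 * pi * l)))"
    using l_pos by (intro Ln_of_real) simp
  finally show ?thesis .
qed

text \<open>Since \<open>exp (Re (pole m j))\<close> is \<open>(2 * pi * m) powr (1 / k)\<close>,
  the terms are of order \<open>exp (- c * m powr (1 / k))\<close> with some \<open>c > 0\<close>,
  eventually below \<open>1 / m^2\<close>.\<close>

lemma summable_Lt_pole:
  assumes "j \<in> index_set k"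
  shows "summable (\<lambda>m. Lt (pole (Suc m) j))"
proof -
  have re: "exp (Re (pole m j)) = (2 * pi * real m) powr (1 / k)" if "m \<ge> 1" for m
    using that by (simp add: pole_def powr_def)
  have ev: "\<forall>\<^sub>F m in sequentially. 1 \<le> c0 * (2 * pi * real m) powr K"
    "\<forall>\<^sub>F m in sequentially. 2 * exp (- (c0 * (2 * pi * real m) powr K)) \<le> inverse (real m ^ 2)" if "K > 0" for K
    using c0_pos that by real_asymp+
  have K: "1 / real k > 0" using k2 by simp
  have "\<forall>\<^sub>F m in sequentially. norm (Lt (pole m j)) \<le> inverse (real m ^ 2)"
    using ev(1)[OF K] ev(2)[OF K] eventually_ge_at_top[of 1]
  proof eventually_elim
    case (elim m)
    have "Im (pole m j) \<in> {theta..pi - theta}" using pole_bounds[OF assms, of m] theta_pos by auto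
    then have "norm (Lt (pole m j)) \<le> 2 * exp (- (c0 * exp (Re (pole m j))))"
      using elim re[of m] by (intro norm_Lt_top) auto
    then show ?case using elim re[of m] by simp
  qed
  moreover have "summable (\<lambda>m. inverse (real m ^ 2))" by (rule inverse_power_summable) simp
  ultimately have "summable (\<lambda>m. Lt (pole m j))" by (rule summable_comparison_test_ev)
  then show ?thesis by (subst summable_Suc_iff)
qed

text \<open>The residues give only the limit of the joint partial sums over all \<open>j\<close>.
  Summability for each single \<open>j\<close> allows the sum over \<open>j\<close> to be taken
  outside.\<close>

lemma sum_Lt_suminf:
  "(\<Sum>j\<in>index_set k. \<Sum>m. Lt (pole (Suc m) j))
     = of_real (- (k / 2) * ln (1 - exp (- 2 * pi * l)) - Im I3 / pi)"
proof (rule LIMSEQ_unique)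
  have "(\<lambda>n. \<Sum>j\<in>index_set k. \<Sum>m<n. Lt (pole (Suc m) j)) \<longlonglongrightarrow> (\<Sum>j\<in>index_set k. \<Sum>m. Lt (pole (Suc m) j))"
    using summable_Lt_pole by (intro tendsto_sum summable_LIMSEQ)
  moreover have "(\<Sum>j\<in>index_set k. \<Sum>m<n. Lt (pole (Suc m) j)) = (\<Sum>m=1..n. \<Sum>j\<in>index_set k. Lt (pole m j))" for n
    by (subst sum.swap) (simp add: sum.atLeast1_atMost_eq)
  ultimately show "(\<lambda>n. \<Sum>m=1..n. \<Sum>j\<in>index_set k. Lt (pole m j)) \<longlonglongrightarrow> (\<Sum>j\<in>index_set k. \<Sum>m. Lt (pole (Suc m) j))"
    by simp
  show "(\<lambda>n. \<Sum>m=1..n. \<Sum>j\<in>index_set k. Lt (pole m j)) \<longlonglongrightarrow> of_real (- (k / 2) * ln (1 - exp (- 2 * pi * l)) - Im I3 / pi)"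
    using sum_Lt_limit unfolding Lt_i by simp
qed

lemma ln_one_minus_exp_sums_integrals:
  "(\<lambda>d. - ln (1 - exp (- ((real (Suc d) / l) ^ k)))) sums
     (l * Re J - Im I1 / pi + k / 2 * ln (sinh (pi * l) / (pi * l)))"
proof -
  have "(\<lambda>n. \<Sum>d=1..n. Ht (of_real (ln (real d / l)))) 
     = (\<lambda>n. of_real (\<Sum>d=1..n. - ln (1 - exp (- ((real d / l) ^ k))) - k / 2 * ln (1 + (l / real d)\<^sup>2)))"
    unfolding of_real_sum by (intro ext sum.cong refl Ht_real) simp
  with sum_Ht_limit_J have "(\<lambda>n. complex_of_real (\<Sum>d=1..n. - ln (1 - exp (- ((real d / l) ^ k))) - k / 2 * ln (1 + (l / real d)\<^sup>2)))
     \<longlonglongrightarrow> l * J - of_real (Im I1 / pi)" by simp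
  also have "l * J - of_real (Im I1 / pi) = of_real (l * Re J - Im I1 / pi)" by (simp add: J_eq)
  finally have "(\<lambda>n. \<Sum>d=1..n. - ln (1 - exp (- ((real d / l) ^ k))) - k / 2 * ln (1 + (l / real d)\<^sup>2))
     \<longlonglongrightarrow> l * Re J - Im I1 / pi" unfolding tendsto_of_real_iff .
  from tendsto_add[OF this tendsto_mult[OF tendsto_const[of "k / 2"] sum_ln_sinh_limit[OF l_pos]]]
  have "(\<lambda>n. \<Sum>d=1..n. - ln (1 - exp (- ((real d / l) ^ k)))) \<longlonglongrightarrow> (l * Re J - Im I1 / pi + k / 2 * ln (sinh (pi * l) / (pi * l)))"
    by (simp add: sum_distrib_left sum_subtractf)
  then show ?thesis by (simp add: sums_def sum.atLeast1_atMost_eq del: of_nat_Suc)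
qed

text \<open>After multiplication by \<open>k / 2\<close>, the first summand cancels the
  \<open>- k * pi / 2\<close> in \<open>J\<close> and the second cancels the residue at
  \<open>z = \<i>\<close>.\<close>

lemma log_sinh:
  "ln (sinh (pi * l) / (pi * l)) = pi * l + ln (1 - exp (- 2 * pi * l)) - ln (2 * pi * l)"
proof -
  have "sinh (pi * l) / (pi * l) = exp (pi * l) * (1 - exp (- 2 * pi * l)) / (2 * pi * l)"
    by (simp add: sinh_field_def right_diff_distrib flip: exp_add)
  also have "ln \<dots> = pi * l + ln (1 - exp (- 2 * pi * l)) - ln (2 * pi * l)"
    using l_pos by (subst ln_div ln_mult; simp)+
  finally show ?thesis .
qed

text \<open>\<open>I1_eq\<close> replaces \<open>Im I1\<close> by \<open>- Im I3\<close>, and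
  \<open>sum_Lt_suminf\<close> expresses \<open>Im I3\<close> through the logarithmic series, so
  both ray integrals drop out.\<close>

lemma ln_one_minus_exp_sums:
  "(\<lambda>d. - ln (1 - exp (- ((real (Suc d) / l) ^ k)))) sums
     (l * (Gamma (1 / k) / k * Re (zeta (of_real (1 + 1 / real k)))) - k / 2 * ln (2 * pi * l)
        - Re (\<Sum>j\<in>index_set k. \<Sum>m. Lt (pole (Suc m) j)))"
proof -
  have "l * Re J - Im I1 / pi + k / 2 * ln (sinh (pi * l) / (pi * l))
    = l * (Gamma (1 / k) / k * Re (zeta (of_real (1 + 1 / real k)))) - k / 2 * ln (2 * pi * l)
        - Re (\<Sum>j\<in>index_set k. \<Sum>m. Lt (pole (Suc m) j))"
    unfolding sum_Lt_suminf log_sinh I1_eq by (simp add: J_eq algebra_simps)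
  with ln_one_minus_exp_sums_integrals show ?thesis by simp
qed

end

theorem theorem3p6:
  fixes k :: nat and x :: real
  assumes "k \<ge> 2" and "even k" and "x > 0"
  shows "(\<forall>j\<in>index_set k. summable (\<lambda>m. log_term k x j (Suc m))) \<and>
    (\<lambda>n. complex_of_real (D k (- 1) (Suc n) * exp (- real (Suc n) * x))) sums
      (1 / 2 * Ln (of_real (x / (2 * pi) ^ k))
       + 1 / of_nat k * Gamma (1 / of_nat k) * zeta (1 + 1 / of_nat k)
           * of_real (x powr (- 1 / real k))
       + (- 1) ^ k * (\<Sum>j\<in>index_set k. exp (\<i> * of_real pi * of_int j)
                         * (\<Sum>m. log_term k x j (Suc m))))"
proof -
  define l where "l = x powr (- 1 / real k)"
  interpret even_lambert k l
    using assms by unfold_locales (auto simp: l_def)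
  have kpos: "real k > 0" using assms by simp
  have lk: "l ^ k = 1 / x"
  proof -
    have "l ^ k = l powr real k" using assms by (intro powr_realpow[symmetric]) (simp add: l_def)
    also have "\<dots> = x powr - 1" unfolding l_def powr_powr using kpos by simp
    finally show ?thesis using assms by (simp add: powr_minus inverse_eq_divide)
  qed
  \<comment> \<open>The angle \<open>pi / 2\<close> in \<open>pole\<close> contributes a factor
    \<open>\<i>\<close>, which meets the \<open>\<i>\<close> of the kernel and gives the minus sign
    in \<open>log_term\<close>.\<close>
  have log_term_eq: "log_term k x j (Suc m) = Lt (pole (Suc m) j)" for j m
  proof -
    define r where "r = 2 * pi * (2 * pi * real (Suc m)) powr (1 / real k) * l"
    define w where "w = \<i> * of_real pi * of_int j / (2 * of_nat k)"
    have re: "exp (ln (2 * pi * real (Suc m)) / k) = (2 * pi * real (Suc m)) powr (1 / real k)"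
      by (simp add: powr_def)
    have "pole (Suc m) j = of_real (ln (2 * pi * real (Suc m)) / k) + \<i> * (pi / 2) - w"
      using kpos by (simp add: pole_def w_def complex_eq_iff)
    then have "exp (pole (Suc m) j) = of_real (exp (ln (2 * pi * real (Suc m)) / k)) * exp (\<i> * (pi / 2)) * exp (- w)"
      by (simp only: exp_add exp_diff exp_minus exp_of_real divide_inverse)
    also have "exp (\<i> * (pi / 2)) = \<i>" by (simp add: complex_eq_iff Re_exp Im_exp)
    finally have 1: "2 * pi * \<i> * l * exp (pole (Suc m) j) = - (exp (- w) * of_real r)"
      unfolding re r_def by (simp add: mult_ac)
    have "(2 * pi) powr (1 + 1 / real k) * (real (Suc m) / x) powr (1 / real k) = r"
      using assms(3) by (simp add: r_def l_def powr_add powr_mult powr_divide powr_minus field_simps del: of_nat_Suc)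
    then have "- exp (- w) * of_real ((2 * pi) powr (1 + 1 / real k)) * of_real ((real (Suc m) / x) powr (1 / real k)) = - (exp (- w) * of_real r)"
      by (simp only: mult.assoc of_real_mult[symmetric] mult_minus_left)
    then show ?thesis unfolding log_term_def Lt_def 1 w_def by (simp only:)
  qed
  \<comment> \<open>As \<open>k\<close> is even, every \<open>j\<close> in the index set is odd.
    This phase supplies the minus sign before \<open>T\<close>, since
    \<open>(- 1) ^ k = 1\<close>.\<close>
  have expj: "exp (\<i> * of_real pi * of_int j) = - 1" if "j \<in> index_set k" for j
  proof -
    have "odd j" using that assms by (auto simp: index_set_def)
    then obtain i where "j = 2 * i + 1" by (elim oddE)
    then have "\<i> * of_real pi * of_int j = 2 * of_int i * of_real pi * \<i> + of_real pi * \<i>"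
      by (simp add: algebra_simps)
    then show ?thesis using exp_integer_2pi[of "of_int i"] by (simp add: exp_add)
  qed
  define T where "T = (\<Sum>j\<in>index_set k. \<Sum>m. Lt (pole (Suc m) j))"
  \<comment> \<open>Reality is read off the closed form given by the residues, without pairing
    \<open>j\<close> with \<open>- j\<close>.\<close>
  have T: "T = of_real (Re T)" unfolding T_def sum_Lt_suminf by simp
  define Y where "Y = l * (Gamma (1 / k) / k * Re (zeta (of_real (1 + 1 / real k)))) - k / 2 * ln (2 * pi * l) - Re T"
  have "(\<lambda>d. - ln (1 - exp (- ((real (Suc d) / l) ^ k)))) sums Y"
    using ln_one_minus_exp_sums unfolding Y_def T_def .
  moreover have "(real (Suc d) / l) ^ k = real (Suc d) ^ k * x" for d
    using lk assms by (simp add: power_divide del: of_nat_Suc)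
  ultimately have "(\<lambda>d. - ln (1 - exp (- (real (Suc d) ^ k * x)))) sums Y" by (simp del: of_nat_Suc)
  then have "(\<lambda>n. D k (- 1) (Suc n) * exp (- real (Suc n) * x)) sums Y"
    using assms by (intro D_exp_sums) auto
  then have "(\<lambda>n. complex_of_real (D k (- 1) (Suc n) * exp (- real (Suc n) * x))) sums of_real Y"
    by (rule sums_of_real)
  moreover have "of_real Y = 1 / 2 * Ln (of_real (x / (2 * pi) ^ k))
       + 1 / of_nat k * Gamma (1 / of_nat k) * zeta (1 + 1 / of_nat k)
           * of_real (x powr (- 1 / real k))
       + (- 1) ^ k * (\<Sum>j\<in>index_set k. exp (\<i> * of_real pi * of_int j)
                         * (\<Sum>m. log_term k x j (Suc m)))"
  proof -
    have "Ln (of_real (x / (2 * pi) ^ k)) = of_real (ln (x / (2 * pi) ^ k))"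
      using assms by (intro Ln_of_real) auto
    \<comment> \<open>This is \<open>l ^ k = 1 / x\<close> in logarithmic form.\<close>
    moreover have "1 / 2 * ln (x / (2 * pi) ^ k) = - (k / 2 * ln (2 * pi * l))"
      using assms by (simp add: l_def ln_div ln_realpow ln_mult ln_powr field_simps)
    ultimately have "1 / 2 * Ln (of_real (x / (2 * pi) ^ k)) = of_real (- (k / 2 * ln (2 * pi * l)))"
      by simp
    then have A: "1 / 2 * Ln (of_real (x / (2 * pi) ^ k)) = - of_real (k / 2 * ln (2 * pi * l))"
      by (simp only: of_real_minus)
    have "zeta (of_real (1 + 1 / real k)) = of_real (Re (zeta (of_real (1 + 1 / real k))))"
      using zeta_real_sums(2)[of "1 + 1 / real k"] kpos by simp
    then have B: "zeta (1 + 1 / of_nat k) = of_real (Re (zeta (of_real (1 + 1 / real k))))" by simp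
    have C: "Gamma (1 / of_nat k) = complex_of_real (Gamma (1 / real k))"
      using Gamma_complex_of_real[of "1 / real k"] by simp
    have E: "(\<Sum>j\<in>index_set k. exp (\<i> * of_real pi * of_int j) * (\<Sum>m. log_term k x j (Suc m))) = - T"
      unfolding T_def sum_negf[symmetric] by (intro sum.cong) (auto simp: expj log_term_eq)
    show ?thesis unfolding A B C E Y_def using assms(2) T by (simp add: l_def mult_ac)
  qed
  ultimately show ?thesis using summable_Lt_pole by (simp add: log_term_eq del: of_nat_Suc)
qed

end
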